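(* Let $N:\mathbb{R}^{\geq 0}\to(0,\infty)$ be a piecewise-continuous, nondecreasing function, let $Z(\sigma)\in\mathbb{C}[\sigma]$ be a polynomial of degree $d=\deg Z$, and let $E\in C_{\mathrm c}^\infty((0,\infty))$. Let $$\alpha(\sigma)=\begin{cases}\langle\sigma\rangle^{1-d}\,(N(\sigma)-Z(\sigma)+E(\sigma)) & (\sigma\ge 0),\\ 0 & (\sigma<0),\end{cases}$$ and suppose that the singular support of $\mathcal{F}N$, and hence that of $a=\mathcal{F}\alpha$, is discrete. Suppose further that 1. $\alpha\in L^\infty(\mathbb{R})$, and 2. $a(\tau)\in \tau L^{1,\ell}_{\mathrm{loc}}(\mathbb{R}_\tau)$ for some integer $\ell\ge 1$. Set $$\mathcal{R}_0(\Sigma)=\max\Big\{1,\ \sup\big\{T>0:\ T\,\lVert t^{-1}a(t)\rVert_{L^{1,\ell}[-T,+T]}\le \Sigma^\ell\big\}\Big\}.$$ Then $$N(\Sigma)=Z(\Sigma)+O\big(\Sigma^{d-1}\mathcal{R}_0(\Sigma)^{-1/2}\big)\quad\text{as }\Sigma\to\infty.$$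
   Context: Notation: $\langle\sigma\rangle=(1+\sigma^2)^{1/2}$. The Fourier transform of tempered distributions uses the convention $\mathcal{F}\alpha(\tau)=\int_{-\infty}^{\infty}e^{-i\tau\sigma}\alpha(\sigma)\,d\sigma$. Functions given on $\mathbb{R}^{\ge0}$ (such as $N$) are extended by $0$ to the negative half-line before taking the Fourier transform. For $\ell\in\mathbb{N}$, $L^{1,\ell}(I)$ denotes the $L^1$-based Sobolev space of functions whose distributional derivatives of order $\le \ell$ all lie in $L^1(I)$, with norm $\lVert u\rVert_{L^{1,\ell}(I)}=\sum_{j=0}^{\ell}\lVert\partial^j u\rVert_{L^1(I)}$. $L^{1,\ell}_{\mathrm{loc}}$ is the corresponding local space. The statement $a\in\tau L^{1,\ell}_{\mathrm{loc}}(\mathbb{R}_\tau)$ means $a(\tau)=\tau u(\tau)$ with $u\in L^{1,\ell}_{\mathrm{loc}}(\mathbb{R})$, and then $t^{-1}a(t)$ denotes $u(t)$. *)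

theory Defs
  imports "HOL-Analysis.Analysis" "HOL-Library.Landau_Symbols"
begin

section \<open>Smooth functions and test functions on the real line\<close>

definition nth_deriv :: "nat \<Rightarrow> (real \<Rightarrow> complex) \<Rightarrow> real \<Rightarrow> complex" where
  "nth_deriv n f = ((\<lambda>g x. vector_derivative g (at x)) ^^ n) f"

text \<open>Meant for open \<open>U\<close>.\<close>

definition smooth_on :: "real set \<Rightarrow> (real \<Rightarrow> complex) \<Rightarrow> bool" where
  "smooth_on U f \<longleftrightarrow> (\<forall>n. \<forall>x\<in>U. nth_deriv n f differentiable (at x))"

text \<open>The space \<open>C\<^sub>c\<^sup>\<infinity>(U)\<close>, its elements being extended by \<open>0\<close> to the whole line.\<close>

definition test_functions :: "real set \<Rightarrow> (real \<Rightarrow> complex) set" where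
  "test_functions U =
     {\<phi>. smooth_on UNIV \<phi> \<and> compact (closure {x. \<phi> x \<noteq> 0}) \<and> closure {x. \<phi> x \<noteq> 0} \<subseteq> U}"

section \<open>Distributions\<close>

text \<open>
  A distribution is represented by the functional it induces on functions; two distributions
  are compared only through their values on test functions, which also determine a tempered
  distribution. Linearity and continuity are not built into the type: every distribution used
  is obtained from a function by the operations below.
\<close>

type_synonym distr = "(real \<Rightarrow> complex) \<Rightarrow> complex"

definition distr_of :: "(real \<Rightarrow> complex) \<Rightarrow> distr" where
  "distr_of f = (\<lambda>\<phi>. LINT x|lebesgue. f x * \<phi> x)"

definition distr_eq_on :: "real set \<Rightarrow> distr \<Rightarrow> distr \<Rightarrow> bool" where
  "distr_eq_on U S T \<longleftrightarrow> (\<forall>\<phi>\<in>test_functions U. S \<phi> = T \<phi>)"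

definition distr_deriv :: "nat \<Rightarrow> distr \<Rightarrow> distr" where
  "distr_deriv j T = (\<lambda>\<phi>. (-1) ^ j * T (nth_deriv j \<phi>))"

definition fourier :: "(real \<Rightarrow> complex) \<Rightarrow> real \<Rightarrow> complex" where
  "fourier f \<tau> = (LINT \<sigma>|lebesgue. exp (- \<i> * of_real (\<tau> * \<sigma>)) * f \<sigma>)"

text \<open>For test functions \<open>\<phi>\<close> the argument \<open>fourier \<phi>\<close> below is a Schwartz function.\<close>

definition distr_fourier :: "distr \<Rightarrow> distr" where
  "distr_fourier T = (\<lambda>\<phi>. T (fourier \<phi>))"

definition sing_supp :: "distr \<Rightarrow> real set" where
  "sing_supp T =
     {x. \<not> (\<exists>U g. open U \<and> x \<in> U \<and> smooth_on U g \<and> distr_eq_on U T (distr_of g))}"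

section \<open>Function spaces\<close>

definition Linfty :: "(real \<Rightarrow> complex) set" where
  "Linfty = {f \<in> borel_measurable lebesgue. \<exists>C. AE x in lebesgue. cmod (f x) \<le> C}"

text \<open>
  \<open>v\<close> represents the distributional derivative of order \<open>j\<close> of \<open>u\<close> on the interval \<open>I\<close>,
  and \<open>v \<in> L\<^sup>1(I)\<close>. Such a \<open>v\<close> is unique up to null sets.
\<close>

definition has_L1_deriv ::
  "real set \<Rightarrow> nat \<Rightarrow> (real \<Rightarrow> complex) \<Rightarrow> (real \<Rightarrow> complex) \<Rightarrow> bool" where
  "has_L1_deriv I j u v \<longleftrightarrow>
     v absolutely_integrable_on I \<and>
     distr_eq_on (interior I) (distr_deriv j (distr_of u)) (distr_of v)"

definition sobolev1 :: "nat \<Rightarrow> real set \<Rightarrow> (real \<Rightarrow> complex) set" where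
  "sobolev1 l I = {u. u absolutely_integrable_on I \<and> (\<forall>j\<le>l. \<exists>v. has_L1_deriv I j u v)}"

definition sobolev1_norm :: "nat \<Rightarrow> real set \<Rightarrow> (real \<Rightarrow> complex) \<Rightarrow> real" where
  "sobolev1_norm l I u =
     (\<Sum>j\<le>l. set_lebesgue_integral lebesgue I (\<lambda>x. cmod ((SOME v. has_L1_deriv I j u v) x)))"

definition sobolev1_loc :: "nat \<Rightarrow> (real \<Rightarrow> complex) set" where
  "sobolev1_loc l = {u. \<forall>a b. a < b \<longrightarrow> u \<in> sobolev1 l {a..b}}"

section \<open>The data of the theorem\<close>

text \<open>
  Piecewise continuity on \<open>[0,\<infinity>)\<close>: finitely many discontinuities in every bounded interval,
  and finite one-sided limits everywhere.
\<close>

definition piecewise_continuous :: "(real \<Rightarrow> real) \<Rightarrow> bool" where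
  "piecewise_continuous f \<longleftrightarrow>
     (\<forall>b. \<exists>S. finite S \<and> continuous_on ({0..b} - S) f) \<and>
     (\<forall>x\<ge>0. \<exists>y. (f \<longlongrightarrow> y) (at_right x)) \<and>
     (\<forall>x>0. \<exists>y. (f \<longlongrightarrow> y) (at_left x))"

definition ext_zero :: "(real \<Rightarrow> complex) \<Rightarrow> real \<Rightarrow> complex" where
  "ext_zero f \<sigma> = (if \<sigma> \<ge> 0 then f \<sigma> else 0)"

definition bracket :: "real \<Rightarrow> real" where
  "bracket \<sigma> = sqrt (1 + \<sigma>\<^sup>2)"

definition alpha ::
  "(real \<Rightarrow> real) \<Rightarrow> complex poly \<Rightarrow> (real \<Rightarrow> complex) \<Rightarrow> real \<Rightarrow> complex" where
  "alpha N Z E = ext_zero (\<lambda>\<sigma>. of_real (bracket \<sigma> powi (1 - int (degree Z))) *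
     (of_real (N \<sigma>) - poly Z (of_real \<sigma>) + E \<sigma>))"

text \<open>
  Here \<open>u\<close> stands for \<open>t\<^sup>-\<^sup>1 a(t)\<close>. The supremum is taken in the extended reals; it is \<open>\<infinity>\<close>
  when \<open>u\<close> vanishes almost everywhere.
\<close>

definition R0 :: "nat \<Rightarrow> (real \<Rightarrow> complex) \<Rightarrow> real \<Rightarrow> ereal" where
  "R0 l u \<Sigma> = max 1 (SUP T \<in> {T. T > 0 \<and> T * sobolev1_norm l {-T..T} u \<le> \<Sigma> ^ l}. ereal T)"

text \<open>The power \<open>R powr (-1/2)\<close> on \<open>[1,\<infinity>]\<close>, with value \<open>0\<close> at \<open>\<infinity>\<close>.\<close>

definition inv_sqrt :: "ereal \<Rightarrow> real" where
  "inv_sqrt R = sqrt (real_of_ereal (inverse R))"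

end

theory Submission
  imports Defs "HOL-Probability.Sinc_Integral" "HOL-Real_Asymp.Real_Asymp"
begin

text \<open>
  Write \<open>\<alpha>\<close> for \<open>alpha N Z E\<close>, and let \<open>T \<ge> 1\<close> be such that \<open>T \<parallel>u\<parallel> \<le> \<Sigma>\<^sup>l\<close> for the Sobolev norm on
  \<open>[-T, T]\<close>. Fix a bump function \<open>\<rho>\<close> on \<open>(-1, 1)\<close> and let \<open>\<Sigma>/2 \<le> a \<le> b\<close>. Testing the identity
  between the Fourier transform of \<open>\<alpha>\<close> and \<open>\<tau> u(\<tau>)\<close> against \<open>\<rho>(\<tau>/T) \<integral>\<^bsub>a\<^esub>\<^bsup>b\<^esup> e\<^bsup>is\<tau>\<^esup> ds\<close> gives, on one side,
  the integral of \<open>\<alpha>\<close> over \<open>[a, b]\<close> (times a nonzero constant) up to an error \<open>O(1/T)\<close>, because \<open>\<alpha>\<close> is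
  bounded. On the other side the factor \<open>\<tau>\<close> cancels and there remain two oscillatory integrals of \<open>u\<close>
  at the frequencies \<open>a\<close> and \<open>b\<close>, which \<open>l\<close> integrations by parts bound by \<open>O(\<Sigma>\<^sup>-\<^sup>l \<parallel>u\<parallel>) = O(1/T)\<close>.
  So all integrals of \<open>\<alpha>\<close> over intervals in \<open>[\<Sigma>/2, \<infinity>)\<close> are \<open>O(1/T)\<close>. As \<open>N\<close> is nondecreasing, \<open>\<alpha>\<close>
  cannot fall faster than linearly, so a value of size \<open>\<delta>\<close> at \<open>\<Sigma>\<close> produces an integral of size
  \<open>\<delta>\<^sup>2\<close> next to \<open>\<Sigma>\<close>; hence \<open>\<bar>\<alpha>(\<Sigma>)\<bar>\<^sup>2 = O(1/T)\<close>, and \<open>T\<close> may approach \<open>R0 l u \<Sigma>\<close>.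
\<close>

subsection \<open>Smooth functions\<close>

lemma nth_deriv_0 [simp]: "nth_deriv 0 f = f"
  by (simp add: nth_deriv_def)

lemma nth_deriv_Suc: "nth_deriv (Suc n) f = (\<lambda>x. vector_derivative (nth_deriv n f) (at x))"
  by (simp add: nth_deriv_def)

lemma nth_deriv_nth_deriv: "nth_deriv m (nth_deriv n f) = nth_deriv (m + n) f"
  by (simp add: nth_deriv_def funpow_add)

lemma nth_deriv_has_vector_derivative:
  "smooth_on UNIV f \<Longrightarrow> (nth_deriv n f has_vector_derivative nth_deriv (Suc n) f x) (at x)"
  by (simp add: smooth_on_def nth_deriv_Suc vector_derivative_works)

lemma smooth_has_vector_derivative:
  "smooth_on UNIV f \<Longrightarrow> (f has_vector_derivative nth_deriv 1 f x) (at x)"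
  using nth_deriv_has_vector_derivative[of f 0] by simp

lemma smooth_nth_deriv: "smooth_on UNIV f \<Longrightarrow> smooth_on UNIV (nth_deriv n f)"
  by (simp add: smooth_on_def nth_deriv_nth_deriv)

lemma continuous_on_nth_deriv: "smooth_on UNIV f \<Longrightarrow> continuous_on S (nth_deriv n f)"
  by (meson continuous_at_imp_continuous_on nth_deriv_has_vector_derivative
      has_vector_derivative_continuous)

lemma continuous_on_smooth: "smooth_on UNIV f \<Longrightarrow> continuous_on S f"
  using continuous_on_nth_deriv[of f S 0] by simp

lemma nth_deriv_Suc_eqI:
  assumes "\<And>x. (nth_deriv n f has_vector_derivative f' x) (at x)"
  shows "nth_deriv (Suc n) f = f'"
  unfolding nth_deriv_Suc using vector_derivative_at[OF assms] by (rule ext)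

lemma nth_deriv_1_eqI: "(\<And>x. (f has_vector_derivative f' x) (at x)) \<Longrightarrow> nth_deriv 1 f = f'"
  using nth_deriv_Suc_eqI[of 0 f f'] by simp

text \<open>Iterated derivatives never have to be computed: a class of functions closed under
  differentiation contains all of them, and each of its members is differentiable.\<close>

lemma smooth_on_coinduct [consumes 1, case_names step]:
  assumes "P f"
    and step: "\<And>f. P f \<Longrightarrow> \<exists>f'. (\<forall>x. (f has_vector_derivative f' x) (at x)) \<and> P f'"
  shows "smooth_on UNIV f"
proof -
  have "P (nth_deriv n f)" for n
  proof (induction n)
    case (Suc n)
    then obtain f' where "\<And>x. (nth_deriv n f has_vector_derivative f' x) (at x)" "P f'"
      using step by blast
    then show ?case
      using nth_deriv_Suc_eqI[of n f f'] by simp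
  qed (simp add: assms(1))
  then show ?thesis
    using step unfolding smooth_on_def
    by (metis differentiableI_vector)
qed

lemma smooth_on_family:
  assumes "\<And>n x. (F n has_vector_derivative F (Suc n) x) (at x)"
  shows "smooth_on UNIV (F n)"
proof (rule smooth_on_coinduct[where P = "\<lambda>f. \<exists>n. f = F n"])
  fix f assume "\<exists>n. f = F n"
  then obtain n where "f = F n" ..
  then show "\<exists>f'. (\<forall>x. (f has_vector_derivative f' x) (at x)) \<and> (\<exists>n. f' = F n)"
    using assms[of n] by (intro exI[of _ "F (Suc n)"]) auto
qed auto

text \<open>The invariant class for smoothness of products. The Leibniz rule turns a product of
  smooth functions into a sum of two such products, so closing under sums makes the class stable and
  no binomial formula is needed.\<close>

inductive_set product_span :: "(real \<Rightarrow> complex) set" where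
  mult: "smooth_on UNIV f \<Longrightarrow> smooth_on UNIV g \<Longrightarrow> (\<lambda>x. f x * g x) \<in> product_span"
| add: "h \<in> product_span \<Longrightarrow> k \<in> product_span \<Longrightarrow> (\<lambda>x. h x + k x) \<in> product_span"

lemma product_span_has_vector_derivative:
  "h \<in> product_span \<Longrightarrow> \<exists>h'. (\<forall>x. (h has_vector_derivative h' x) (at x)) \<and> h' \<in> product_span"
proof (induction rule: product_span.induct)
  case (mult f g)
  have "((\<lambda>x. f x * g x) has_vector_derivative f x * nth_deriv 1 g x + nth_deriv 1 f x * g x) (at x)"
    for x
    using mult smooth_has_vector_derivative by (intro has_vector_derivative_mult) auto
  moreover have "(\<lambda>x. f x * nth_deriv 1 g x + nth_deriv 1 f x * g x) \<in> product_span"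
    using mult smooth_nth_deriv by (intro product_span.intros) auto
  ultimately show ?case
    by (intro exI[of _ "\<lambda>x. f x * nth_deriv 1 g x + nth_deriv 1 f x * g x"]) simp
next
  case (add h k)
  then obtain h' k' where "\<forall>x. (h has_vector_derivative h' x) (at x)" "h' \<in> product_span"
    "\<forall>x. (k has_vector_derivative k' x) (at x)" "k' \<in> product_span" by blast
  then show ?case
    by (intro exI[of _ "\<lambda>x. h' x + k' x"]) (auto intro: has_vector_derivative_add product_span.add)
qed

lemma smooth_mult:
  assumes "smooth_on UNIV f" "smooth_on UNIV g"
  shows "smooth_on UNIV (\<lambda>x. f x * g x)"
  by (rule smooth_on_coinduct[where P = "\<lambda>h. h \<in> product_span"],
      rule product_span.mult[OF assms], erule product_span_has_vector_derivative)

lemma smooth_const: "smooth_on UNIV (\<lambda>x. c)"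
proof (rule smooth_on_coinduct[where P = "\<lambda>f. \<exists>c. f = (\<lambda>x. c)"])
  fix f :: "real \<Rightarrow> complex" assume "\<exists>c. f = (\<lambda>x. c)"
  then have "\<forall>x. (f has_vector_derivative 0) (at x)"
    by auto
  then show "\<exists>f'. (\<forall>x. (f has_vector_derivative f' x) (at x)) \<and> (\<exists>c. f' = (\<lambda>x. c))"
    by (intro exI[of _ "\<lambda>x. 0"]) auto
qed auto

lemma smooth_cmult: "smooth_on UNIV f \<Longrightarrow> smooth_on UNIV (\<lambda>x. c * f x)"
  by (rule smooth_mult[OF smooth_const])

lemma has_vector_derivative_affine:
  fixes f :: "real \<Rightarrow> complex"
  assumes "\<And>x. (f has_vector_derivative f' x) (at x)"
  shows "((\<lambda>x. f (a * x + b)) has_vector_derivative of_real a * f' (a * x + b)) (at x)"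
proof -
  have "((\<lambda>x. a * x + b) has_vector_derivative a) (at x)"
    by (auto intro!: derivative_eq_intros simp flip: has_real_derivative_iff_has_vector_derivative)
  from vector_diff_chain_at[OF this assms]
  show ?thesis by (simp add: o_def scaleR_conv_of_real)
qed

lemma smooth_affine:
  assumes "smooth_on UNIV f"
  shows "smooth_on UNIV (\<lambda>x. f (a * x + b))"
proof -
  \<comment> \<open>The chain rule brings out a factor \<open>a\<close> at every differentiation;
    the free constant \<open>c\<close> absorbs these factors.\<close>
  let ?P = "\<lambda>h. \<exists>c g. smooth_on UNIV g \<and> h = (\<lambda>x. c * g (a * x + b))"
  have "?P (\<lambda>x. f (a * x + b))"
    using assms by (intro exI[of _ 1] exI[of _ f]) auto
  then show ?thesis
  proof (rule smooth_on_coinduct[where P = ?P])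
    fix h assume "?P h"
    then obtain c g where g: "smooth_on UNIV g" "h = (\<lambda>x. c * g (a * x + b))"
      by blast
    have "(h has_vector_derivative (c * of_real a) * nth_deriv 1 g (a * x + b)) (at x)" for x
      using has_vector_derivative_mult_right[OF has_vector_derivative_affine[of g "nth_deriv 1 g" a b x], of c]
        smooth_has_vector_derivative[OF g(1)] g(2) by (simp add: mult.assoc)
    moreover have "?P (\<lambda>x. (c * of_real a) * nth_deriv 1 g (a * x + b))"
      using smooth_nth_deriv[OF g(1), of 1] by blast
    ultimately show "\<exists>h'. (\<forall>x. (h has_vector_derivative h' x) (at x)) \<and> ?P h'"
      by (intro exI[of _ "\<lambda>x. (c * of_real a) * nth_deriv 1 g (a * x + b)"]) simp
  qed
qed

lemma nth_deriv_scale: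
  assumes "smooth_on UNIV f"
  shows "nth_deriv n (\<lambda>x. f (a * x)) = (\<lambda>x. of_real a ^ n * nth_deriv n f (a * x))"
proof (induction n)
  case (Suc n)
  have "((\<lambda>x. of_real a ^ n * nth_deriv n f (a * x)) has_vector_derivative
      of_real a ^ Suc n * nth_deriv (Suc n) f (a * x)) (at x)" for x
    using has_vector_derivative_mult_right[OF has_vector_derivative_affine
        [OF nth_deriv_has_vector_derivative[OF assms], of n a 0 x], of "of_real a ^ n"]
    by (simp add: mult_ac)
  then show ?case
    by (intro nth_deriv_Suc_eqI) (simp only: Suc)
qed simp

lemma nth_deriv_add:
  assumes "smooth_on UNIV f" "smooth_on UNIV g"
  shows "nth_deriv n (\<lambda>x. f x + g x) = (\<lambda>x. nth_deriv n f x + nth_deriv n g x)"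
proof (induction n)
  case (Suc n)
  have "((\<lambda>x. nth_deriv n f x + nth_deriv n g x) has_vector_derivative
      nth_deriv (Suc n) f x + nth_deriv (Suc n) g x) (at x)" for x
    using assms nth_deriv_has_vector_derivative by (intro has_vector_derivative_add) auto
  then show ?case
    by (intro nth_deriv_Suc_eqI) (simp only: Suc)
qed simp

lemma nth_deriv_cmult:
  assumes "smooth_on UNIV f"
  shows "nth_deriv n (\<lambda>x. c * f x) = (\<lambda>x. c * nth_deriv n f x)"
proof (induction n)
  case (Suc n)
  have "((\<lambda>x. c * nth_deriv n f x) has_vector_derivative c * nth_deriv (Suc n) f x) (at x)" for x
    using assms nth_deriv_has_vector_derivative by (intro has_vector_derivative_mult_right) auto
  then show ?case
    by (intro nth_deriv_Suc_eqI) (simp only: Suc)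
qed simp

text \<open>The complement of the closure is open, so the function vanishes in a neighbourhood of
  the point and all derivatives there follow by induction.\<close>

lemma nth_deriv_zero_outside_closure:
  assumes "x \<notin> closure {x. f x \<noteq> 0}"
  shows "nth_deriv n f x = 0"
proof -
  let ?U = "- closure {x. f x \<noteq> 0}"
  have U: "open ?U" by auto
  have "\<forall>x\<in>?U. nth_deriv n f x = 0"
  proof (induction n)
    case 0
    then show ?case using closure_subset[of "{x. f x \<noteq> 0}"] by auto
  next
    case (Suc n)
    show ?case
    proof
      fix x assume x: "x \<in> ?U"
      have "(nth_deriv n f has_vector_derivative 0) (at x)"
        by (rule has_vector_derivative_transform_within_open[OF _ U x, of "\<lambda>x. 0"]) (use Suc in auto)
      then show "nth_deriv (Suc n) f x = 0"
        by (simp add: nth_deriv_Suc vector_derivative_at)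
    qed
  qed
  then show ?thesis using assms by auto
qed

lemma vector_derivative_exp_wave:
  "((\<lambda>\<tau>. exp (\<i> * of_real (s * \<tau>))) has_vector_derivative \<i> * of_real s * exp (\<i> * of_real (s * \<tau>))) (at \<tau>)"
proof -
  have "((\<lambda>z. exp (\<i> * of_real s * z)) has_field_derivative \<i> * of_real s * exp (\<i> * of_real s * of_real \<tau>)) (at (of_real \<tau>))"
    by (auto intro!: derivative_eq_intros)
  from has_vector_derivative_real_field[OF this] show ?thesis
    by (simp add: mult.assoc)
qed

lemma smooth_exp_wave: "smooth_on UNIV (\<lambda>\<tau>. exp (\<i> * of_real (s * \<tau>)))"
proof -
  define F where "F n \<tau> = (\<i> * of_real s) ^ n * exp (\<i> * of_real (s * \<tau>))" for n \<tau>
  have "(F n has_vector_derivative F (Suc n) \<tau>) (at \<tau>)" for n \<tau>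
    unfolding F_def
    using has_vector_derivative_mult_right[OF vector_derivative_exp_wave[of s \<tau>], of "(\<i> * of_real s) ^ n"]
    by (simp add: mult_ac)
  then have "smooth_on UNIV (F 0)"
    by (rule smooth_on_family)
  then show ?thesis by (simp add: F_def[abs_def])
qed

subsection \<open>Test functions\<close>

lemma test_functions_smooth: "\<phi> \<in> test_functions U \<Longrightarrow> smooth_on UNIV \<phi>"
  by (simp add: test_functions_def)

lemma test_functionsI:
  assumes "smooth_on UNIV \<phi>" "compact K" "K \<subseteq> U" "\<And>x. x \<notin> K \<Longrightarrow> \<phi> x = 0"
  shows "\<phi> \<in> test_functions U"
proof -
  have "closure {x. \<phi> x \<noteq> 0} \<subseteq> K"
    by (rule closure_minimal) (use assms compact_imp_closed in auto)
  then show ?thesis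
    using assms compact_Int_closed[of K "closure {x. \<phi> x \<noteq> 0}"]
    by (auto simp: test_functions_def inf.absorb2)
qed

lemma test_functions_zero_outside:
  "\<phi> \<in> test_functions U \<Longrightarrow> x \<notin> U \<Longrightarrow> nth_deriv n \<phi> x = 0"
  using nth_deriv_zero_outside_closure[of x \<phi>] by (auto simp: test_functions_def)

lemma test_functions_mono: "U \<subseteq> V \<Longrightarrow> test_functions U \<subseteq> test_functions V"
  by (auto simp: test_functions_def)

lemma test_functions_mult:
  assumes "\<phi> \<in> test_functions U" "smooth_on UNIV g"
  shows "(\<lambda>x. \<phi> x * g x) \<in> test_functions U"
proof (rule test_functionsI[of _ "closure {x. \<phi> x \<noteq> 0}"])
  show "\<phi> x * g x = 0" if "x \<notin> closure {x. \<phi> x \<noteq> 0}" for x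
    using nth_deriv_zero_outside_closure[OF that, of 0] by simp
qed (use assms smooth_mult in \<open>simp_all add: test_functions_def\<close>)

lemma test_functions_nth_deriv:
  assumes "\<phi> \<in> test_functions U"
  shows "nth_deriv n \<phi> \<in> test_functions U"
proof (rule test_functionsI[of _ "closure {x. \<phi> x \<noteq> 0}"])
  show "nth_deriv n \<phi> x = 0" if "x \<notin> closure {x. \<phi> x \<noteq> 0}" for x
    using that by (rule nth_deriv_zero_outside_closure)
qed (use assms smooth_nth_deriv in \<open>simp_all add: test_functions_def\<close>)

lemma test_functions_bounded:
  assumes "\<phi> \<in> test_functions U"
  obtains B where "\<And>x. cmod (\<phi> x) \<le> B" "B \<ge> 0"
proof -
  let ?K = "closure {x. \<phi> x \<noteq> 0}"
  have "compact (\<phi> ` ?K)"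
    using assms by (intro compact_continuous_image continuous_on_smooth) (auto simp: test_functions_def)
  then obtain B where B: "\<forall>y\<in>\<phi> ` ?K. cmod y \<le> B" using compact_imp_bounded bounded_iff by metis
  have "cmod (\<phi> x) \<le> max B 0" for x
    using B nth_deriv_zero_outside_closure[of x \<phi> 0] by (cases "x \<in> ?K") (auto simp: le_max_iff_disj)
  then show thesis using that[of "max B 0"] by auto
qed

lemma has_integral_test_deriv:
  assumes "\<phi> \<in> test_functions {a<..<b}" "a < b"
  shows "(nth_deriv 1 \<phi> has_integral 0) {a..b}"
proof -
  have "(nth_deriv 1 \<phi> has_integral \<phi> b - \<phi> a) {a..b}"
    using assms smooth_has_vector_derivative[OF test_functions_smooth[OF assms(1)]]
    by (intro fundamental_theorem_of_calculus) (auto intro: has_vector_derivative_at_within)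
  then show ?thesis
    using test_functions_zero_outside[OF assms(1), of a 0] test_functions_zero_outside[OF assms(1), of b 0] by simp
qed

subsection \<open>A bump function\<close>

text \<open>For \<open>p = 1\<close> this is the classical function exp(-1/x), flat at 0. The
  polynomial in 1/x makes the family closed under differentiation.\<close>

definition flat :: "real poly \<Rightarrow> real \<Rightarrow> real" where
  "flat p x = (if x > 0 then poly p (1 / x) * exp (- (1 / x)) else 0)"

lemma tendsto_poly_exp: "((\<lambda>y. poly p y * exp (- y)) \<longlongrightarrow> (0::real)) at_top"
proof -
  have "((\<lambda>y. \<Sum>i\<le>degree p. coeff p i * (y ^ i / exp y)) \<longlongrightarrow> (\<Sum>i\<le>degree p. coeff p i * 0)) at_top"
    by (intro tendsto_intros tendsto_power_div_exp_0)
  then show ?thesis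
    by (simp add: poly_altdef sum_distrib_right exp_minus divide_inverse mult.assoc)
qed

text \<open>With y = 1/x the derivative d/dx is -y^2 d/dy, which sends p(y) exp(-y) to y^2 (p(y) -
  p'(y)) exp(-y); \<open>[:0, 0, 1:]\<close> is the factor y^2. Only x = 0 needs a limit.\<close>

lemma flat_has_derivative: "(flat p has_real_derivative flat ([:0, 0, 1:] * (p - pderiv p)) x) (at x)"
proof -
  consider "x > 0" | "x < 0" | "x = 0" by linarith
  then show ?thesis
  proof cases
    case 1
    have "((\<lambda>x. poly p (1 / x) * exp (- (1 / x))) has_real_derivative
        flat ([:0, 0, 1:] * (p - pderiv p)) x) (at x)"
      using 1 by (auto intro!: derivative_eq_intros DERIV_chain'[OF _ poly_DERIV]
          simp: flat_def field_simps power2_eq_square)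
    then show ?thesis
      by (rule has_field_derivative_transform_within_open[where S = "{0<..}"])
         (use 1 in \<open>auto simp: flat_def\<close>)
  next
    case 2
    have "((\<lambda>x. 0) has_real_derivative 0) (at x)" by simp
    then have "(flat p has_real_derivative 0) (at x)"
      by (rule has_field_derivative_transform_within_open[where S = "{..<0}"])
         (use 2 in \<open>auto simp: flat_def\<close>)
    then show ?thesis using 2 by (simp add: flat_def)
  next
    case 3
    \<comment> \<open>For h > 0 the difference quotient at 0 is y p(y) exp(-y) with y = 1/h, and
      \<open>pCons 0 p\<close> absorbs the additional factor y.\<close>
    have "((\<lambda>h. poly (pCons 0 p) (inverse h) * exp (- inverse h)) \<longlongrightarrow> 0) (at_right (0::real))"
      by (rule filterlim_compose[OF tendsto_poly_exp filterlim_inverse_at_top_right])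
    then have "((\<lambda>h. flat p h / h) \<longlongrightarrow> 0) (at_right 0)"
      by (rule Lim_transform_eventually)
         (auto simp: flat_def eventually_at_right_less field_simps intro!: eventually_at_rightI[of 0 1])
    moreover have "((\<lambda>h. flat p h / h) \<longlongrightarrow> 0) (at_left 0)"
      by (rule tendsto_eventually) (auto simp: flat_def intro!: eventually_at_leftI[of "-1" 0])
    ultimately have "((\<lambda>h. flat p h / h) \<longlongrightarrow> 0) (at 0)"
      by (simp add: filterlim_split_at)
    then show ?thesis using 3 by (simp add: DERIV_def flat_def)
  qed
qed

lemma smooth_flat: "smooth_on UNIV (\<lambda>x. of_real (flat p x))"
proof (rule smooth_on_coinduct[where P = "\<lambda>f. \<exists>p. f = (\<lambda>x. of_real (flat p x))"])
  fix f :: "real \<Rightarrow> complex" assume "\<exists>p. f = (\<lambda>x. of_real (flat p x))"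
  then obtain p where "f = (\<lambda>x. of_real (flat p x))" by blast
  then have "\<forall>x. (f has_vector_derivative of_real (flat ([:0, 0, 1:] * (p - pderiv p)) x)) (at x)"
    using flat_has_derivative by (auto simp only: intro!: has_vector_derivative_of_real)
  then show "\<exists>f'. (\<forall>x. (f has_vector_derivative f' x) (at x)) \<and> (\<exists>p. f' = (\<lambda>x. of_real (flat p x)))"
    by (rule exI[of _ "\<lambda>x. of_real (flat ([:0, 0, 1:] * (p - pderiv p)) x)", OF conjI])
       (rule exI, rule refl)
qed blast

lemma bump_exists:
  obtains \<rho> where "\<rho> \<in> test_functions {-1<..<1}" "\<rho> 0 \<noteq> 0"
proof
  \<comment> \<open>The two factors vanish left of -1/2 and right of 1/2. The redundant-looking
    \<open>1 * x\<close> keeps the shape \<open>a * x + b\<close> of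
    \<open>smooth_affine\<close>.\<close>
  let ?\<rho> = "\<lambda>x. complex_of_real (flat 1 (1 * x + 1/2)) * complex_of_real (flat 1 ((-1) * x + 1/2))"
  show "?\<rho> \<in> test_functions {-1<..<1}"
  proof (rule test_functionsI[of _ "{-1/2..1/2}"])
    show "smooth_on UNIV ?\<rho>"
      by (intro smooth_mult smooth_affine[OF smooth_flat])
  qed (auto simp: flat_def)
  show "?\<rho> 0 \<noteq> 0" by (simp add: flat_def)
qed

subsection \<open>Integrals of waves over a band of frequencies\<close>

text \<open>For \<tau> \<noteq> 0 this is (exp(ib\<tau>) - exp(ia\<tau>)) / (i\<tau>). The integral
  form is smooth at \<tau> = 0 as well, so it can multiply a test function.\<close>

definition band :: "real \<Rightarrow> real \<Rightarrow> real \<Rightarrow> complex" where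
  "band a b \<tau> = integral {a..b} (\<lambda>s. exp (\<i> * of_real (s * \<tau>)))"

lemma smooth_band: "smooth_on UNIV (band a b)"
proof -
  define F where "F n \<tau> = integral (cbox a b) (\<lambda>s. (\<i> * of_real s) ^ n * exp (\<i> * of_real (s * \<tau>)))"
    for n \<tau>
  have "(F n has_vector_derivative F (Suc n) \<tau>) (at \<tau>)" for n \<tau>
    unfolding F_def
  proof (rule leibniz_rule_vector_derivative[of UNIV])
    show "((\<lambda>\<tau>. (\<i> * of_real s) ^ n * exp (\<i> * of_real (s * \<tau>))) has_vector_derivative
        (\<i> * of_real s) ^ Suc n * exp (\<i> * of_real (s * \<tau>))) (at \<tau>)" for \<tau> s
      using has_vector_derivative_mult_right[OF vector_derivative_exp_wave[of s \<tau>], of "(\<i> * of_real s) ^ n"]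
      by (simp add: mult_ac)
    show "(\<lambda>s. (\<i> * of_real s) ^ n * exp (\<i> * of_real (s * \<tau>))) integrable_on cbox a b" for \<tau>
      by (intro integrable_continuous continuous_intros)
    show "continuous_on (UNIV \<times> cbox a b) (\<lambda>(\<tau>, s). (\<i> * of_real s) ^ Suc n * exp (\<i> * of_real (s * \<tau>)))"
      unfolding split_beta by (intro continuous_intros)
  qed auto
  then have "smooth_on UNIV (F 0)"
    by (rule smooth_on_family)
  moreover have "F 0 = band a b"
    by (simp add: F_def band_def fun_eq_iff)
  ultimately show ?thesis by simp
qed

text \<open>This is how the factor \<tau> in the transform of \<alpha> gets absorbed: only the two
  waves at the endpoint frequencies survive.\<close>

lemma band_mult_frequency:
  assumes "a \<le> b"
  shows "\<i> * of_real \<tau> * band a b \<tau> = exp (\<i> * of_real (b * \<tau>)) - exp (\<i> * of_real (a * \<tau>))"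
proof -
  have "((\<lambda>s. exp (\<i> * of_real (s * \<tau>))) has_vector_derivative
      \<i> * of_real \<tau> * exp (\<i> * of_real (s * \<tau>))) (at s within {a..b})" for s
    using has_vector_derivative_at_within[OF vector_derivative_exp_wave[of \<tau> s]]
    by (simp only: mult.commute[of \<tau>])
  then have "((\<lambda>s. \<i> * of_real \<tau> * exp (\<i> * of_real (s * \<tau>))) has_integral
      exp (\<i> * of_real (b * \<tau>)) - exp (\<i> * of_real (a * \<tau>))) {a..b}"
    by (rule fundamental_theorem_of_calculus[OF assms])
  moreover have "((\<lambda>s. \<i> * of_real \<tau> * exp (\<i> * of_real (s * \<tau>))) has_integral
      \<i> * of_real \<tau> * band a b \<tau>) {a..b}"
    unfolding band_def
    by (intro has_integral_mult_right integrable_integral integrable_continuous_real continuous_intros)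
  ultimately show ?thesis using has_integral_unique by blast
qed

text \<open>Expresses the Dirichlet kernel through \<open>sinc\<close>, whose primitive
  \<open>Si\<close> has a known limit at infinity; \<open>sinc\<close> also covers \<tau> =
  0.\<close>

lemma band_symmetric:
  assumes "X \<ge> 0"
  shows "band (-X) X \<tau> = of_real (2 * X * sinc (X * \<tau>))"
proof (cases "\<tau> = 0 \<or> X = 0")
  case True
  then show ?thesis using assms by (auto simp: band_def scaleR_conv_of_real)
next
  case False
  have "\<i> * of_real \<tau> * band (-X) X \<tau> = 2 * \<i> * of_real (sin (X * \<tau>))"
    using assms by (subst band_mult_frequency) (auto simp: complex_eq_iff exp_eq_polar cis.ctr)
  then have "\<i> * (of_real \<tau> * band (-X) X \<tau>) = \<i> * of_real (2 * sin (X * \<tau>))"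
    by (simp add: mult_ac)
  then have "of_real \<tau> * band (-X) X \<tau> = of_real (2 * sin (X * \<tau>))"
    by (simp only: mult_left_cancel[OF complex_i_not_zero])
  then show ?thesis using False by (auto simp: field_simps)
qed

subsection \<open>Integrals against functions of bounded support\<close>

text \<open>The integrals run over the whole line while \<open>v\<close> is controlled only on the
  interval; the vanishing of \<open>\<psi>\<close> outside lets \<open>v\<close> be cut off
  there.\<close>

lemma integral_mult_bounded_support:
  fixes v \<psi> :: "real \<Rightarrow> complex"
  assumes v: "v absolutely_integrable_on {a..b}"
    and \<psi>: "continuous_on UNIV \<psi>" "\<And>x. x \<notin> {a..b} \<Longrightarrow> \<psi> x = 0" "\<And>x. cmod (\<psi> x) \<le> B"
  shows "integrable lebesgue (\<lambda>x. v x * \<psi> x)"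
    and "cmod (LINT x|lebesgue. v x * \<psi> x) \<le> B * (LINT x:{a..b}|lebesgue. cmod (v x))"
proof -
  have eq: "v x * \<psi> x = (indicator {a..b} x *\<^sub>R v x) * \<psi> x" for x
    using \<psi>(2)[of x] by (auto simp: indicator_def)
  have v': "integrable lebesgue (\<lambda>x. indicator {a..b} x *\<^sub>R v x)"
    using v by (simp add: set_integrable_def)
  have meas: "\<psi> \<in> borel_measurable lebesgue"
    using \<psi>(1) by (intro measurable_completion) (simp add: borel_measurable_continuous_onI)
  have bd: "cmod (v x * \<psi> x) \<le> B * cmod (indicator {a..b} x *\<^sub>R v x)" for x
    unfolding eq norm_mult using mult_left_mono[OF \<psi>(3)[of x] norm_ge_zero[of "indicator {a..b} x *\<^sub>R v x"]]
    by (simp only: mult.commute)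
  have iB: "integrable lebesgue (\<lambda>x. B * cmod (indicator {a..b} x *\<^sub>R v x))"
    using v' by (intro integrable_mult_right integrable_norm)
  show i: "integrable lebesgue (\<lambda>x. v x * \<psi> x)"
  proof (rule Bochner_Integration.integrable_bound[OF iB])
    show "(\<lambda>x. v x * \<psi> x) \<in> borel_measurable lebesgue"
      unfolding eq using borel_measurable_integrable[OF v'] meas by (rule borel_measurable_times)
    show "AE x in lebesgue. norm (v x * \<psi> x) \<le> norm (B * cmod (indicator {a..b} x *\<^sub>R v x))"
      using bd by (intro AE_I2) (metis abs_ge_self order_trans real_norm_def)
  qed
  have "cmod (LINT x|lebesgue. v x * \<psi> x) \<le> (LINT x|lebesgue. cmod (v x * \<psi> x))"
    by (rule integral_norm_bound)
  also have "\<dots> \<le> (LINT x|lebesgue. B * cmod (indicator {a..b} x *\<^sub>R v x))"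
    using i iB bd by (intro integral_mono integrable_norm) auto
  also have "\<dots> = B * (LINT x:{a..b}|lebesgue. cmod (v x))"
    by (simp add: set_lebesgue_integral_def)
  finally show "cmod (LINT x|lebesgue. v x * \<psi> x) \<le> B * (LINT x:{a..b}|lebesgue. cmod (v x))" .
qed

lemma lebesgue_integral_bounded_support:
  fixes \<psi> :: "real \<Rightarrow> complex"
  assumes "continuous_on UNIV \<psi>" "\<And>x. x \<notin> {a..b} \<Longrightarrow> \<psi> x = 0"
  shows "(LINT x|lebesgue. \<psi> x) = integral {a..b} \<psi>"
proof -
  have "\<psi> absolutely_integrable_on {a..b}"
    using assms(1) by (intro absolutely_integrable_continuous_real) (rule continuous_on_subset, auto)
  then have "(LINT x:{a..b}|lebesgue. \<psi> x) = integral {a..b} \<psi>"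
    by (rule set_lebesgue_integral_eq_integral)
  moreover have "(\<lambda>x. indicator {a..b} x *\<^sub>R \<psi> x) = \<psi>"
    using assms(2) by (auto simp: indicator_def fun_eq_iff)
  ultimately show ?thesis by (simp add: set_lebesgue_integral_def)
qed

subsection \<open>Fourier transforms of test functions\<close>

lemma fourier_bounded_support:
  assumes "continuous_on UNIV \<phi>" "\<And>x. x \<notin> {a..b} \<Longrightarrow> \<phi> x = 0"
  shows "fourier \<phi> x = integral {a..b} (\<lambda>\<sigma>. exp (\<i> * of_real (- x * \<sigma>)) * \<phi> \<sigma>)"
proof -
  have "fourier \<phi> x = (LINT \<sigma>|lebesgue. exp (\<i> * of_real (- x * \<sigma>)) * \<phi> \<sigma>)"
    by (simp add: fourier_def)
  also have "\<dots> = integral {a..b} (\<lambda>\<sigma>. exp (\<i> * of_real (- x * \<sigma>)) * \<phi> \<sigma>)"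
    using assms by (intro lebesgue_integral_bounded_support continuous_intros) auto
  finally show ?thesis .
qed

lemma test_functions_zero_outside_Icc:
  "\<phi> \<in> test_functions {a<..<b} \<Longrightarrow> x \<notin> {a..b} \<Longrightarrow> \<phi> x = 0"
  using test_functions_zero_outside[of \<phi> "{a<..<b}" x 0] by auto

lemma fourier_test:
  assumes "\<phi> \<in> test_functions {a<..<b}"
  shows "fourier \<phi> x = integral {a..b} (\<lambda>\<sigma>. exp (\<i> * of_real (- x * \<sigma>)) * \<phi> \<sigma>)"
  using continuous_on_smooth[OF test_functions_smooth[OF assms]]
    test_functions_zero_outside_Icc[OF assms]
  by (rule fourier_bounded_support)

text \<open>Integration by parts: the product of \<phi> with the wave is again a test function, so
  its derivative has integral 0.\<close>

lemma fourier_deriv: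
  assumes \<phi>: "\<phi> \<in> test_functions {a<..<b}" and "a < b"
  shows "fourier (nth_deriv 1 \<phi>) x = \<i> * of_real x * fourier \<phi> x"
proof -
  let ?w = "\<lambda>\<sigma>. exp (\<i> * of_real (- x * \<sigma>))"
  let ?\<psi> = "\<lambda>\<sigma>. \<phi> \<sigma> * ?w \<sigma>"
  have "nth_deriv 1 ?\<psi> = (\<lambda>\<sigma>. \<phi> \<sigma> * (\<i> * of_real (- x) * ?w \<sigma>) + nth_deriv 1 \<phi> \<sigma> * ?w \<sigma>)"
    using smooth_has_vector_derivative[OF test_functions_smooth[OF \<phi>]] vector_derivative_exp_wave[of "- x"]
    by (intro nth_deriv_1_eqI has_vector_derivative_mult)
  moreover have "?\<psi> \<in> test_functions {a<..<b}"
    by (intro test_functions_mult \<phi> smooth_exp_wave)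
  ultimately have 0: "((\<lambda>\<sigma>. \<phi> \<sigma> * (\<i> * of_real (- x) * ?w \<sigma>) + nth_deriv 1 \<phi> \<sigma> * ?w \<sigma>) has_integral 0) {a..b}"
    using has_integral_test_deriv[of ?\<psi> a b] \<open>a < b\<close> by simp
  have cont: "continuous_on {a..b} \<phi>"
    using continuous_on_smooth[OF test_functions_smooth[OF \<phi>]] .
  have 1: "((\<lambda>\<sigma>. \<i> * of_real x * (?w \<sigma> * \<phi> \<sigma>)) has_integral \<i> * of_real x * fourier \<phi> x) {a..b}"
    unfolding fourier_test[OF \<phi>]
    by (intro has_integral_mult_right integrable_integral integrable_continuous_real continuous_intros cont)
  have "((\<lambda>\<sigma>. ?w \<sigma> * nth_deriv 1 \<phi> \<sigma>) has_integral \<i> * of_real x * fourier \<phi> x) {a..b}"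
    using has_integral_add[OF 0 1] by (simp add: algebra_simps)
  then show ?thesis
    by (subst fourier_test[OF test_functions_nth_deriv[OF \<phi>]]) (rule integral_unique)
qed

lemma fourier_nth_deriv:
  assumes \<phi>: "\<phi> \<in> test_functions {a<..<b}" and "a < b"
  shows "fourier (nth_deriv n \<phi>) x = (\<i> * of_real x) ^ n * fourier \<phi> x"
proof (induction n)
  case (Suc n)
  have "nth_deriv (Suc n) \<phi> = nth_deriv 1 (nth_deriv n \<phi>)"
    by (simp add: nth_deriv_nth_deriv)
  then show ?case
    using fourier_deriv[OF test_functions_nth_deriv[OF \<phi>] \<open>a < b\<close>, of n x] Suc by simp
qed simp

lemma fourier_test_bounded:
  assumes \<phi>: "\<phi> \<in> test_functions {a<..<b}" and "a < b"
  obtains B where "B \<ge> 0" "\<And>x. cmod (fourier \<phi> x) \<le> B"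
proof -
  obtain B where B: "\<And>x. cmod (\<phi> x) \<le> B" "B \<ge> 0" using test_functions_bounded[OF \<phi>] by blast
  have "cmod (fourier \<phi> x) \<le> B * (b - a)" for x
    unfolding fourier_test[OF \<phi>] using \<open>a < b\<close> B
    by (intro integral_bound continuous_intros continuous_on_smooth[OF test_functions_smooth[OF \<phi>]])
       (auto simp: norm_mult)
  then show thesis using that[of "B * (b - a)"] B \<open>a < b\<close> by simp
qed

text \<open>Three derivatives buy the factor |x|^3. The exponent 3 is chosen so that a primitive
  still approaches its limits at the integrable rate (1 + |x|)^(-2).\<close>

lemma fourier_test_decay:
  assumes \<phi>: "\<phi> \<in> test_functions {a<..<b}" and "a < b"
  obtains C where "C \<ge> 0" "\<And>x. cmod (fourier \<phi> x) \<le> C / (1 + \<bar>x\<bar>) ^ 3"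
proof -
  obtain B0 where B0: "B0 \<ge> 0" "\<And>x. cmod (fourier \<phi> x) \<le> B0"
    using fourier_test_bounded[OF assms] by blast
  obtain B3 where B3: "B3 \<ge> 0" "\<And>x. cmod (fourier (nth_deriv 3 \<phi>) x) \<le> B3"
    using fourier_test_bounded[OF test_functions_nth_deriv[OF \<phi>] \<open>a < b\<close>] by blast
  have "cmod (fourier \<phi> x) \<le> 4 * (B0 + B3) / (1 + \<bar>x\<bar>) ^ 3" for x
  proof -
    have "\<bar>x\<bar> ^ 3 * cmod (fourier \<phi> x) \<le> B3"
      using B3(2)[of x] by (simp add: fourier_nth_deriv[OF assms] norm_mult norm_power)
    moreover have "(1 + \<bar>x\<bar>) ^ 3 \<le> 4 * (1 + \<bar>x\<bar> ^ 3)"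
    proof -
      have "4 * (1 + \<bar>x\<bar> ^ 3) - (1 + \<bar>x\<bar>) ^ 3 = 3 * (1 - \<bar>x\<bar>)\<^sup>2 * (1 + \<bar>x\<bar>)"
        by (simp add: power2_eq_square power3_eq_cube algebra_simps)
      also have "\<dots> \<ge> 0" by simp
      finally show ?thesis by simp
    qed
    then have "(1 + \<bar>x\<bar>) ^ 3 * cmod (fourier \<phi> x) \<le> 4 * (1 + \<bar>x\<bar> ^ 3) * cmod (fourier \<phi> x)"
      by (intro mult_right_mono) auto
    ultimately have "(1 + \<bar>x\<bar>) ^ 3 * cmod (fourier \<phi> x) \<le> 4 * (B0 + B3)"
      using B0(2)[of x] by (simp add: algebra_simps)
    moreover have "(1 + \<bar>x\<bar>) ^ 3 > 0" by (intro zero_less_power) linarith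
    ultimately show ?thesis by (simp add: pos_le_divide_eq mult.commute)
  qed
  then show thesis using that[of "4 * (B0 + B3)"] B0 B3 by simp
qed

lemma continuous_on_fourier_test:
  assumes "\<phi> \<in> test_functions {a<..<b}"
  shows "continuous_on UNIV (fourier \<phi>)"
proof -
  have c: "continuous_on UNIV \<phi>"
    using continuous_on_smooth[OF test_functions_smooth[OF assms]] .
  have "continuous_on UNIV (\<lambda>x. integral (cbox a b) (\<lambda>\<sigma>. exp (\<i> * of_real (- x * \<sigma>)) * \<phi> \<sigma>))"
    by (intro integral_continuous_on_param)
       (auto simp: split_beta intro!: continuous_intros continuous_on_compose2[OF c])
  then show ?thesis by (simp add: fourier_test[OF assms, abs_def])
qed

lemma fourier_scale:
  assumes \<phi>: "\<phi> \<in> test_functions {a<..<b}" and "T > 0"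
  shows "fourier (\<lambda>\<tau>. \<phi> (\<tau> / T)) x = of_real T * fourier \<phi> (T * x)"
proof -
  let ?f = "\<lambda>\<tau>. exp (- \<i> * of_real (x * \<tau>)) * \<phi> (\<tau> / T)"
  have c: "continuous_on UNIV \<phi>"
    using continuous_on_smooth[OF test_functions_smooth[OF \<phi>]] .
  have "continuous_on UNIV ?f" 
    using \<open>T > 0\<close> by (intro continuous_intros continuous_on_compose2[OF c]) auto
  then have m: "?f \<in> borel_measurable lborel"
    by (simp add: borel_measurable_continuous_onI)
  have "continuous_on UNIV (\<lambda>\<sigma>. exp (- \<i> * of_real (T * x * \<sigma>)) * \<phi> \<sigma>)" 
    using c by (intro continuous_intros)
  then have m': "(\<lambda>\<sigma>. exp (- \<i> * of_real (T * x * \<sigma>)) * \<phi> \<sigma>) \<in> borel_measurable lborel"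
    by (simp add: borel_measurable_continuous_onI)
  \<comment> \<open>The integrals are moved to \<open>lborel\<close>, where the affine substitution
    is stated; this is why Borel measurability was checked above.\<close>
  have "fourier (\<lambda>\<tau>. \<phi> (\<tau> / T)) x = (LINT \<tau>|lborel. ?f \<tau>)"
    unfolding fourier_def by (rule integral_completion[OF m])
  also have "\<dots> = T *\<^sub>R (LINT \<sigma>|lborel. ?f (0 + T * \<sigma>))"
    using lborel_integral_real_affine[of T ?f 0] \<open>T > 0\<close> by simp
  also have "\<dots> = of_real T * fourier \<phi> (T * x)"
    unfolding fourier_def integral_completion[OF m'] using \<open>T > 0\<close>
    by (simp add: scaleR_conv_of_real mult_ac)
  finally show ?thesis .
qed

section \<open>Primitives of decaying functions and their limits\<close>

lemma has_vector_derivative_primitive_exists: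
  fixes f :: "real \<Rightarrow> complex"
  assumes "continuous_on UNIV f"
  obtains F where "\<And>x. (F has_vector_derivative f x) (at x)"
proof
  fix x :: real
  \<comment> \<open>The interval contains the base point 0 and has \<open>x\<close> in its interior,
    so the derivative within it is a derivative on the line.\<close>
  have "(at x within {min 0 (x - 1)..max 0 (x + 1)}) = at x"
    by (intro at_within_interior) auto
  moreover have "min 0 (x - 1) \<le> x" "x \<le> max 0 (x + 1)"
    by auto
  ultimately show "((\<lambda>u. LBINT y=ereal 0..ereal u. f y) has_vector_derivative f x) (at x)"
    using interval_integral_FTC2[of "min 0 (x - 1)" 0 "max 0 (x + 1)" f x] assms
    by (auto intro: continuous_on_subset)
qed

text \<open>Increments of \<open>P\<close> are dominated by those of a primitive of the bound on
  \<open>K\<close>. Hence \<open>P\<close> is Cauchy along the integers, and its limit inherits the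
  rate.\<close>

lemma primitive_tends_fast:
  fixes P :: "real \<Rightarrow> complex"
  assumes P: "\<And>x. (P has_vector_derivative K x) (at x)"
    and K: "\<And>x. x \<ge> 0 \<Longrightarrow> cmod (K x) \<le> C / (1 + x) ^ 3" and "C \<ge> 0"
  obtains c where "\<And>x. x \<ge> 0 \<Longrightarrow> cmod (P x - c) \<le> C / (1 + x)\<^sup>2"
proof -
  have step: "cmod (P y - P x) \<le> C / (1 + x)\<^sup>2" if "0 \<le> x" "x \<le> y" for x y
  proof (cases "x = y")
    case False
    \<comment> \<open>A primitive of C / (1 + t)^3; it is nonpositive, so its increment from
      \<open>x\<close> is at most its absolute value at \<open>x\<close>.\<close>
    let ?g = "\<lambda>t. - (C / 2) / (1 + t)\<^sup>2"
    have g: "(?g has_vector_derivative C / (1 + t) ^ 3) (at t)" if "0 \<le> t" for t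
    proof -
      have nz: "1 + t \<noteq> 0" using that by linarith
      have "((\<lambda>t. (1 + t)\<^sup>2) has_real_derivative 2 * (1 + t)) (at t)"
        by (auto intro!: derivative_eq_intros)
      from DERIV_divide[OF DERIV_const[of "- (C / 2)"] this]
      have "(?g has_real_derivative (0 * (1 + t)\<^sup>2 - - (C / 2) * (2 * (1 + t))) / ((1 + t)\<^sup>2 * (1 + t)\<^sup>2)) (at t)"
        using nz by simp
      moreover have "(0 * r\<^sup>2 - - (C / 2) * (2 * r)) / (r\<^sup>2 * r\<^sup>2) = C / r ^ 3" if "r \<noteq> 0" for r
        using that by (simp add: power2_eq_square power3_eq_cube)
      ultimately have "(?g has_real_derivative C / (1 + t) ^ 3) (at t)"
        using nz by metis
      then show ?thesis by (simp add: has_real_derivative_iff_has_vector_derivative)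
    qed
    have "cmod (P y - P x) \<le> ?g y - ?g x"
    proof (rule differentiable_bound_general[of x y P ?g K "\<lambda>t. C / (1 + t) ^ 3"])
      show "continuous_on {x..y} P"
        using P by (meson continuous_at_imp_continuous_on has_vector_derivative_continuous)
      show "continuous_on {x..y} ?g"
        using \<open>0 \<le> x\<close> by (intro continuous_intros) (auto simp: power2_eq_square)
    qed (use P g K that False in auto)
    also have "\<dots> \<le> C / (1 + x)\<^sup>2"
      using \<open>C \<ge> 0\<close> that by (simp add: field_simps)
    finally show ?thesis .
  qed (use \<open>C \<ge> 0\<close> in simp)
  have lim0: "(\<lambda>n. C / (1 + real n)\<^sup>2) \<longlonglongrightarrow> 0"
    by real_asymp
  have "Cauchy (\<lambda>n. P (real n))"
  proof (rule CauchyI')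
    fix e :: real assume "e > 0"
    then have "\<forall>\<^sub>F n in sequentially. C / (1 + real n)\<^sup>2 < e"
      using lim0 by (rule order_tendstoD(2)[rotated])
    then obtain M where M: "\<And>n. n \<ge> M \<Longrightarrow> C / (1 + real n)\<^sup>2 < e"
      by (auto simp: eventually_sequentially)
    show "\<exists>M. \<forall>m\<ge>M. \<forall>n>m. dist (P (real m)) (P (real n)) < e"
    proof (intro exI allI impI)
      fix m n :: nat assume "M \<le> m" "m < n"
      then show "dist (P (real m)) (P (real n)) < e"
        using step[of m n] M[of m] by (simp add: dist_norm norm_minus_commute)
    qed
  qed
  then obtain c where c: "(\<lambda>n. P (real n)) \<longlonglongrightarrow> c"
    using Cauchy_convergent convergent_def by blast
  have "cmod (P x - c) \<le> C / (1 + x)\<^sup>2" if "x \<ge> 0" for x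
  proof (rule tendsto_upperbound)
    show "(\<lambda>n. cmod (P x - P (real n))) \<longlonglongrightarrow> cmod (P x - c)"
      by (intro tendsto_intros c)
    show "\<forall>\<^sub>F n in sequentially. cmod (P x - P (real n)) \<le> C / (1 + x)\<^sup>2"
      using eventually_ge_at_top[of "nat \<lceil>x\<rceil>"]
      by eventually_elim (subst norm_minus_commute, use step[OF that] in simp)
  qed simp
  then show thesis using that by blast
qed

subsection \<open>A smoothing kernel\<close>

lemma test_functions_scale:
  assumes "\<rho> \<in> test_functions {-1<..<1}" "T > 0"
  shows "(\<lambda>\<tau>. \<rho> (\<tau> / T)) \<in> test_functions {-T<..<T}"
proof (rule test_functionsI[of _ "(\<lambda>x. T * x) ` closure {x. \<rho> x \<noteq> 0}"])
  show "smooth_on UNIV (\<lambda>\<tau>. \<rho> (\<tau> / T))"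
    using smooth_affine[OF test_functions_smooth[OF assms(1)], of "1 / T" 0] by simp
  show "compact ((\<lambda>x. T * x) ` closure {x. \<rho> x \<noteq> 0})"
    using assms by (intro compact_continuous_image continuous_intros) (simp add: test_functions_def)
  show "(\<lambda>x. T * x) ` closure {x. \<rho> x \<noteq> 0} \<subseteq> {-T<..<T}"
  proof safe
    fix x assume "x \<in> closure {x. \<rho> x \<noteq> 0}"
    then have "-1 < x" "x < 1" using assms by (auto simp: test_functions_def)
    then show "T * x \<in> {-T<..<T}"
      using mult_strict_left_mono[of "-1" x T] mult_strict_left_mono[of x 1 T] \<open>T > 0\<close> by simp
  qed
  show "\<rho> (x / T) = 0" if "x \<notin> (\<lambda>x. T * x) ` closure {x. \<rho> x \<noteq> 0}" for x
  proof -
    have "x / T \<notin> closure {x. \<rho> x \<noteq> 0}"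
      using that \<open>T > 0\<close> by (auto simp: image_iff)
    then show ?thesis using nth_deriv_zero_outside_closure[of "x / T" \<rho> 0] by simp
  qed
qed

text \<open>Writing \<open>band\<close> as an integral over frequencies s and exchanging the
  integrals leaves the integral of \<open>T * fourier \<rho> (T * (x - s))\<close> over s in [a, b],
  which the primitive \<open>P\<close> evaluates.\<close>

lemma fourier_band:
  assumes \<rho>: "\<rho> \<in> test_functions {-1<..<1}" and T: "T > 0" and "a \<le> b"
    and P: "\<And>x. (P has_vector_derivative fourier \<rho> x) (at x)"
  shows "fourier (\<lambda>\<tau>. \<rho> (\<tau> / T) * band a b \<tau>) x = P (T * (x - a)) - P (T * (x - b))"
proof -
  let ?\<rho> = "\<lambda>\<tau>. \<rho> (\<tau> / T)"
  let ?f = "\<lambda>\<tau> s. exp (\<i> * of_real (- (x - s) * \<tau>)) * ?\<rho> \<tau>"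
  have \<rho>T: "?\<rho> \<in> test_functions {-T<..<T}"
    using test_functions_scale[OF \<rho> T] .
  have c: "continuous_on UNIV ?\<rho>"
    using continuous_on_smooth[OF test_functions_smooth[OF \<rho>T]] .
  have "fourier (\<lambda>\<tau>. ?\<rho> \<tau> * band a b \<tau>) x =
      integral {-T..T} (\<lambda>\<tau>. exp (\<i> * of_real (- x * \<tau>)) * (?\<rho> \<tau> * band a b \<tau>))"
    by (rule fourier_test[OF test_functions_mult[OF \<rho>T smooth_band]])
  also have "\<dots> = integral {-T..T} (\<lambda>\<tau>. integral {a..b} (?f \<tau>))"
  proof (rule integral_cong)
    fix \<tau>
    have "exp (\<i> * of_real (- x * \<tau>)) * (?\<rho> \<tau> * band a b \<tau>) =
        integral {a..b} (\<lambda>s. (exp (\<i> * of_real (- x * \<tau>)) * ?\<rho> \<tau>) * exp (\<i> * of_real (s * \<tau>)))"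
      unfolding band_def integral_mult_right by (simp add: mult_ac)
    also have "\<dots> = integral {a..b} (?f \<tau>)"
      by (intro integral_cong) (simp add: algebra_simps flip: exp_add)
    finally show "exp (\<i> * of_real (- x * \<tau>)) * (?\<rho> \<tau> * band a b \<tau>) = integral {a..b} (?f \<tau>)" .
  qed
  also have "\<dots> = integral {a..b} (\<lambda>s. integral {-T..T} (\<lambda>\<tau>. ?f \<tau> s))"
  proof -
    have "continuous_on (cbox (-T, a) (T, b)) (\<lambda>(\<tau>, s). ?f \<tau> s)"
      unfolding split_beta by (intro continuous_intros continuous_on_compose2[OF c]) auto
    from integral_swap_continuous[OF this] show ?thesis by simp
  qed
  also have "\<dots> = integral {a..b} (\<lambda>s. of_real T * fourier \<rho> (T * (x - s)))"
    by (simp only: fourier_scale[OF \<rho> T, symmetric] fourier_test[OF \<rho>T])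
  also have "\<dots> = - P (T * (x - b)) - - P (T * (x - a))"
  proof (rule integral_unique, rule fundamental_theorem_of_calculus
      [OF \<open>a \<le> b\<close>, where f = "\<lambda>s. - P (T * (x - s))"])
    fix s
    have e: "T * (x - s) = - T * s + T * x" for s
      by (simp add: algebra_simps)
    have "((\<lambda>s. - P (- T * s + T * x)) has_vector_derivative
        - (of_real (- T) * fourier \<rho> (- T * s + T * x))) (at s)"
      by (rule has_vector_derivative_minus, rule has_vector_derivative_affine, rule P)
    moreover have "- (of_real (- T) * fourier \<rho> (- T * s + T * x)) = of_real T * fourier \<rho> (- T * s + T * x)"
      by simp
    ultimately show "((\<lambda>s. - P (T * (x - s))) has_vector_derivative of_real T * fourier \<rho> (T * (x - s)))
        (at s within {a..b})"
      unfolding e by (metis has_vector_derivative_at_within)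
  qed
  finally show ?thesis by simp
qed

section \<open>Fourier inversion at the origin, by way of the sine integral\<close>

lemma Si_at_top_scale: "(\<lambda>n. Si (real n * \<tau>)) \<longlonglongrightarrow> pi / 2 * sgn \<tau>"
proof -
  have pos: "(\<lambda>n. Si (real n * t)) \<longlonglongrightarrow> pi / 2" if "t > 0" for t
    by (rule filterlim_compose[OF Si_at_top])
       (use that in \<open>intro filterlim_tendsto_pos_mult_at_top[OF tendsto_const] filterlim_real_sequentially
          filterlim_at_top_mult_tendsto_pos[OF tendsto_const]\<close>)
  consider "\<tau> > 0" | "\<tau> = 0" | "\<tau> < 0" by linarith
  then show ?thesis
  proof cases
    case 3
    then have "Si (real n * \<tau>) = - Si (real n * - \<tau>)" for n
      using Si_neg[of "real n * - \<tau>"] by (simp add: mult_nonneg_nonpos)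
    then show ?thesis using tendsto_minus[OF pos[of "- \<tau>"]] 3 by simp
  next
    case 2
    have "Si 0 = 0" using Si_neg[of 0] by simp
    then show ?thesis using 2 by simp
  qed (use pos in simp)
qed

text \<open>The kernel is the \<tau>-derivative of \<open>2 * Si (X * \<tau>)\<close>. It is
  unbounded as X grows, whereas \<open>Si\<close> is bounded, so after integrating by parts the
  limit can be taken by dominated convergence.\<close>

lemma integral_band_symmetric:
  assumes \<rho>: "\<rho> \<in> test_functions {-1<..<1}" and "X \<ge> 0"
  shows "integral {-1..1} (\<lambda>\<tau>. \<rho> \<tau> * band (-X) X \<tau>) =
    - 2 * integral {-1..1} (\<lambda>\<tau>. nth_deriv 1 \<rho> \<tau> * of_real (Si (X * \<tau>)))"
proof -
  let ?S = "\<lambda>\<tau>. complex_of_real (2 * Si (X * \<tau>))"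
  have cS: "continuous_on A (\<lambda>\<tau>. Si (X * \<tau>))" for A
    by (intro continuous_on_compose2[OF continuous_at_imp_continuous_on[of UNIV Si]] continuous_intros)
       (auto simp: isCont_Si)
  have cb: "continuous_on A (band (-X) X)" for A
    by (rule continuous_on_smooth[OF smooth_band])
  have c\<rho>: "continuous_on A \<rho>" "continuous_on A (nth_deriv 1 \<rho>)" for A
    using continuous_on_smooth continuous_on_nth_deriv test_functions_smooth[OF \<rho>] by blast+
  have S: "(?S has_vector_derivative band (-X) X \<tau>) (at \<tau>)" for \<tau>
  proof -
    have "((\<lambda>\<tau>. X * \<tau>) has_real_derivative X) (at \<tau>)"
      by (rule DERIV_cmult_Id)
    note * = DERIV_cmult[OF DERIV_chain2[OF DERIV_Si this], of 2]
    have "((\<lambda>\<tau>. 2 * Si (X * \<tau>)) has_real_derivative 2 * X * sinc (X * \<tau>)) (at \<tau>)"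
      by (rule DERIV_cong[OF *]) simp
    then show ?thesis
      unfolding band_symmetric[OF \<open>X \<ge> 0\<close>] by (rule has_vector_derivative_of_real)
  qed
  have "((\<lambda>\<tau>. \<rho> \<tau> * ?S \<tau>) has_vector_derivative \<rho> \<tau> * band (-X) X \<tau> + nth_deriv 1 \<rho> \<tau> * ?S \<tau>)
      (at \<tau> within {-1..1})" for \<tau>
    by (rule has_vector_derivative_at_within, rule has_vector_derivative_mult,
        rule smooth_has_vector_derivative[OF test_functions_smooth[OF \<rho>]], rule S)
  then have "((\<lambda>\<tau>. \<rho> \<tau> * band (-X) X \<tau> + nth_deriv 1 \<rho> \<tau> * ?S \<tau>) has_integral \<rho> 1 * ?S 1 - \<rho> (-1) * ?S (-1)) {-1..1}"
    by (intro fundamental_theorem_of_calculus[where f = "\<lambda>\<tau>. \<rho> \<tau> * ?S \<tau>"]) simp_all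
  moreover have "\<rho> 1 = 0" "\<rho> (-1) = 0"
    using test_functions_zero_outside[OF \<rho>, of 1 0] test_functions_zero_outside[OF \<rho>, of "-1" 0] by auto
  ultimately have "0 = integral {-1..1} (\<lambda>\<tau>. \<rho> \<tau> * band (-X) X \<tau> + nth_deriv 1 \<rho> \<tau> * ?S \<tau>)"
    by (simp add: integral_unique)
  also have "\<dots> = integral {-1..1} (\<lambda>\<tau>. \<rho> \<tau> * band (-X) X \<tau>) + integral {-1..1} (\<lambda>\<tau>. nth_deriv 1 \<rho> \<tau> * ?S \<tau>)"
    by (intro Henstock_Kurzweil_Integration.integral_add integrable_continuous_real continuous_intros c\<rho> cb cS)
  also have "integral {-1..1} (\<lambda>\<tau>. nth_deriv 1 \<rho> \<tau> * ?S \<tau>) =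
      integral {-1..1} (\<lambda>\<tau>. 2 * (nth_deriv 1 \<rho> \<tau> * of_real (Si (X * \<tau>))))"
    by (intro integral_cong) simp
  also have "\<dots> = 2 * integral {-1..1} (\<lambda>\<tau>. nth_deriv 1 \<rho> \<tau> * of_real (Si (X * \<tau>)))"
    by simp
  finally show ?thesis by (simp add: add_eq_0_iff)
qed

text \<open>Each half of the interval contributes \<open>- (pi / 2) * \<rho> 0\<close>: at 0 the
  sign of the weight and the sign of the boundary term change together.\<close>

lemma integral_deriv_sgn:
  assumes \<rho>: "\<rho> \<in> test_functions {-1<..<1}"
  shows "((\<lambda>\<tau>. nth_deriv 1 \<rho> \<tau> * of_real (pi / 2 * sgn \<tau>)) has_integral - of_real pi * \<rho> 0) {-1..1}"
proof -
  note D = has_vector_derivative_at_within[OF smooth_has_vector_derivative[OF test_functions_smooth[OF \<rho>]]]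
  have z: "\<rho> 1 = 0" "\<rho> (-1) = 0"
    using test_functions_zero_outside[OF \<rho>, of 1 0] test_functions_zero_outside[OF \<rho>, of "-1" 0] by auto
  have "(nth_deriv 1 \<rho> has_integral \<rho> 0 - \<rho> (-1)) {-1..0}"
    by (rule fundamental_theorem_of_calculus[where f = \<rho>]) (simp, rule D)
  then have "((\<lambda>\<tau>. nth_deriv 1 \<rho> \<tau> * of_real (- pi / 2)) has_integral \<rho> 0 * of_real (- pi / 2)) {-1..0}"
    using z by (intro has_integral_mult_left) simp
  then have 1: "((\<lambda>\<tau>. nth_deriv 1 \<rho> \<tau> * of_real (pi / 2 * sgn \<tau>)) has_integral \<rho> 0 * of_real (- pi / 2)) {-1..0}"
    by (rule has_integral_spike_finite[of "{0}", rotated 2]) (auto simp: sgn_if)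
  have "(nth_deriv 1 \<rho> has_integral \<rho> 1 - \<rho> 0) {0..1}"
    by (rule fundamental_theorem_of_calculus[where f = \<rho>]) (simp, rule D)
  then have "((\<lambda>\<tau>. nth_deriv 1 \<rho> \<tau> * of_real (pi / 2)) has_integral - \<rho> 0 * of_real (pi / 2)) {0..1}"
    using z by (intro has_integral_mult_left) simp
  then have 2: "((\<lambda>\<tau>. nth_deriv 1 \<rho> \<tau> * of_real (pi / 2 * sgn \<tau>)) has_integral - \<rho> 0 * of_real (pi / 2)) {0..1}"
    by (rule has_integral_spike_finite[of "{0}", rotated 2]) (auto simp: sgn_if)
  show ?thesis
    using has_integral_combine[OF _ _ 1 2] by (simp add: field_simps)
qed

text \<open>Fourier inversion for \<rho> at 0: the Dirichlet kernels tend to 2 pi times the point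
  mass at 0.\<close>

lemma integral_band_symmetric_limit:
  assumes \<rho>: "\<rho> \<in> test_functions {-1<..<1}"
  shows "(\<lambda>n. integral {-1..1} (\<lambda>\<tau>. \<rho> \<tau> * band (- real n) (real n) \<tau>)) \<longlonglongrightarrow> 2 * of_real pi * \<rho> 0"
proof -
  let ?f = "\<lambda>n \<tau>. nth_deriv 1 \<rho> \<tau> * of_real (Si (real n * \<tau>))"
  obtain B where B: "\<And>t. \<bar>Si t\<bar> \<le> B" using bounded_Si by blast
  obtain R where R: "\<And>x. cmod (nth_deriv 1 \<rho> x) \<le> R" "R \<ge> 0"
    using test_functions_bounded[OF test_functions_nth_deriv[OF \<rho>]] by blast
  have "(\<lambda>n. integral {-1..1} (?f n)) \<longlonglongrightarrow> integral {-1..1} (\<lambda>\<tau>. nth_deriv 1 \<rho> \<tau> * of_real (pi / 2 * sgn \<tau>))"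
  proof (rule dominated_convergence(2))
    show "?f n integrable_on {-1..1}" for n
      using test_functions_smooth[OF \<rho>]
      by (intro integrable_continuous_real continuous_intros continuous_on_nth_deriv
          continuous_on_compose2[OF continuous_at_imp_continuous_on[of UNIV Si]]) (auto simp: isCont_Si)
    show "(\<lambda>\<tau>::real. R * B) integrable_on {-1..1}" by (rule integrable_const_ivl)
    show "norm (?f n \<tau>) \<le> R * B" for n \<tau>
      using R B by (auto simp: norm_mult intro!: mult_mono)
    show "(\<lambda>n. ?f n \<tau>) \<longlonglongrightarrow> nth_deriv 1 \<rho> \<tau> * of_real (pi / 2 * sgn \<tau>)" for \<tau>
      by (intro tendsto_intros Si_at_top_scale)
  qed
  then have "(\<lambda>n. integral {-1..1} (?f n)) \<longlonglongrightarrow> - of_real pi * \<rho> 0"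
    using integral_unique[OF integral_deriv_sgn[OF \<rho>]] by simp
  from tendsto_mult_left[OF this, of "-2"] show ?thesis
    by (subst integral_band_symmetric[OF \<rho>]) (simp_all add: mult_ac)
qed

text \<open>\<open>c1\<close> and \<open>c2\<close> are the limits of \<open>P\<close> at plus and
  minus infinity. By \<open>fourier_band\<close> with T = 1 and x = 0 on [-n, n], their difference
  is the inversion limit \<open>2 * pi * \<rho> 0\<close>, nonzero by the choice of the
  bump.\<close>

lemma kernel_exists:
  obtains \<rho> P c1 c2 C where "\<rho> \<in> test_functions {-1<..<1}"
    "\<And>x. (P has_vector_derivative fourier \<rho> x) (at x)" "c1 \<noteq> c2" "C \<ge> 0"
    "\<And>x. x \<ge> 0 \<Longrightarrow> cmod (P x - c1) \<le> C / (1 + \<bar>x\<bar>)\<^sup>2"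
    "\<And>x. x \<le> 0 \<Longrightarrow> cmod (P x - c2) \<le> C / (1 + \<bar>x\<bar>)\<^sup>2"
proof -
  obtain \<rho> where \<rho>: "\<rho> \<in> test_functions {-1<..<1}" "\<rho> 0 \<noteq> 0" using bump_exists by blast
  obtain C where C: "C \<ge> 0" "\<And>x. cmod (fourier \<rho> x) \<le> C / (1 + \<bar>x\<bar>) ^ 3"
    using fourier_test_decay[OF \<rho>(1)] by auto
  obtain P where P: "\<And>x. (P has_vector_derivative fourier \<rho> x) (at x)"
    using has_vector_derivative_primitive_exists[OF continuous_on_fourier_test[OF \<rho>(1)]] by blast
  obtain c1 where c1: "\<And>x. x \<ge> 0 \<Longrightarrow> cmod (P x - c1) \<le> C / (1 + x)\<^sup>2"
    using primitive_tends_fast[OF P, of C] C by (metis abs_of_nonneg)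
  have Q: "((\<lambda>x. P (- x)) has_vector_derivative - fourier \<rho> (- x)) (at x)" for x
    using has_vector_derivative_affine[OF P, of "-1" 0] by simp
  have "cmod (- fourier \<rho> (- x)) \<le> C / (1 + x) ^ 3" if "x \<ge> 0" for x
    using C(2)[of "- x"] that by simp
  from primitive_tends_fast[of "\<lambda>x. P (- x)", OF Q this C(1)]
  obtain c2 where c2: "\<And>x. x \<ge> 0 \<Longrightarrow> cmod (P (- x) - c2) \<le> C / (1 + x)\<^sup>2"
    by blast
  have lim0: "(\<lambda>n. C / (1 + real n)\<^sup>2) \<longlonglongrightarrow> 0"
    by real_asymp
  have l1: "(\<lambda>n. P (real n)) \<longlonglongrightarrow> c1"
    by (rule LIM_zero_cancel, rule Lim_null_comparison[OF _ lim0]) (use c1 in auto)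
  have l2: "(\<lambda>n. P (- real n)) \<longlonglongrightarrow> c2"
    by (rule LIM_zero_cancel, rule Lim_null_comparison[OF _ lim0]) (use c2 in auto)
  have "integral {-1..1} (\<lambda>\<tau>. \<rho> \<tau> * band (- real n) (real n) \<tau>) = P (real n) - P (- real n)" for n
    using fourier_band[OF \<rho>(1) _ _ P, of 1 "- real n" "real n" 0]
      fourier_test[OF test_functions_mult[OF \<rho>(1) smooth_band], of "- real n" "real n" 0]
    by simp
  then have "(\<lambda>n. P (real n) - P (- real n)) \<longlonglongrightarrow> 2 * of_real pi * \<rho> 0"
    using integral_band_symmetric_limit[OF \<rho>(1)] by simp
  then have "c1 - c2 = 2 * of_real pi * \<rho> 0"
    using tendsto_diff[OF l1 l2] LIMSEQ_unique by blast
  then have "c1 \<noteq> c2" using \<rho>(2) by auto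
  moreover have "cmod (P x - c2) \<le> C / (1 + \<bar>x\<bar>)\<^sup>2" if "x \<le> 0" for x
    using c2[of "- x"] that by simp
  moreover have "cmod (P x - c1) \<le> C / (1 + \<bar>x\<bar>)\<^sup>2" if "x \<ge> 0" for x
    using c1[of x] that by simp
  ultimately show thesis using that[OF \<rho>(1) P] C(1) by blast
qed

subsection \<open>Local averages\<close>

text \<open>The Cauchy density is the integrable majorant of the kernel error; its integral is the
  source of the rate 1 / T.\<close>

lemma Cauchy_density_integral:
  assumes "T > 0"
  shows "integrable lebesgue (\<lambda>x. 1 / (1 + (T * (x - a))\<^sup>2))"
    and "(LINT x|lebesgue. 1 / (1 + (T * (x - a))\<^sup>2)) = pi / T"
proof -
  have e: "einterval (-\<infinity>) \<infinity> = UNIV"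
    by (auto simp: einterval_def)
  have i: "integrable lborel (\<lambda>x::real. 1 / (1 + x\<^sup>2))"
    using integrable_inverse_1_plus_square by (simp add: e set_integrable_def inverse_eq_divide)
  have v: "(LINT x|lborel. 1 / (1 + x\<^sup>2)) = pi"
    using LBINT_inverse_1_plus_square
    by (simp add: interval_lebesgue_integral_def e set_lebesgue_integral_def inverse_eq_divide)
  have eq: "T * (x - a) = - (T * a) + T * x" for x
    by (simp add: algebra_simps)
  have "integrable lborel (\<lambda>x. 1 / (1 + (- (T * a) + T * x)\<^sup>2))"
    using i lborel_integrable_real_affine_iff[of T "\<lambda>x. 1 / (1 + x\<^sup>2)" "- (T * a)"] assms by simp
  then show "integrable lebesgue (\<lambda>x. 1 / (1 + (T * (x - a))\<^sup>2))"
    unfolding eq by (subst integrable_completion) auto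
  have "pi = T * (LINT x|lborel. 1 / (1 + (- (T * a) + T * x)\<^sup>2))"
    using lborel_integral_real_affine[of T "\<lambda>x. 1 / (1 + x\<^sup>2)" "- (T * a)"] assms v by simp
  then show "(LINT x|lebesgue. 1 / (1 + (T * (x - a))\<^sup>2)) = pi / T"
    unfolding eq using assms by (subst integral_completion) (auto simp: field_simps)
qed

lemma set_integrable_bounded:
  fixes \<alpha> :: "real \<Rightarrow> complex"
  assumes "\<alpha> \<in> borel_measurable lebesgue" "AE x in lebesgue. cmod (\<alpha> x) \<le> M"
  shows "set_integrable lebesgue {a..b} \<alpha>"
  unfolding set_integrable_def
proof (rule Bochner_Integration.integrable_bound)
  show "integrable lebesgue (\<lambda>x. M * indicator {a..b} x)"
    by (intro integrable_mult_right integrable_real_indicator) (auto simp: emeasure_lborel_Icc_eq)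
  show "(\<lambda>x. indicator {a..b} x *\<^sub>R \<alpha> x) \<in> borel_measurable lebesgue"
    using assms(1) by (intro borel_measurable_scaleR borel_measurable_indicator) auto
  show "AE x in lebesgue. norm (indicator {a..b} x *\<^sub>R \<alpha> x) \<le> norm (M * indicator {a..b} x)"
    using assms(2) by eventually_elim (auto simp: indicator_def)
qed

text \<open>
  Up to an error of size \<open>1 / T\<close> in \<open>L\<^sup>1\<close>, the kernel \<open>P (T (x - a)) - P (T (x - b))\<close> is the
  multiple \<open>c1 - c2\<close> of the indicator of \<open>[a, b]\<close>.
\<close>

lemma average_le_kernel:
  fixes \<alpha> P :: "real \<Rightarrow> complex"
  assumes \<alpha>: "\<alpha> \<in> borel_measurable lebesgue" "AE x in lebesgue. cmod (\<alpha> x) \<le> M"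
    and P: "continuous_on UNIV P" and "C \<ge> 0"
    and c1: "\<And>x. x \<ge> 0 \<Longrightarrow> cmod (P x - c1) \<le> C / (1 + \<bar>x\<bar>)\<^sup>2"
    and c2: "\<And>x. x \<le> 0 \<Longrightarrow> cmod (P x - c2) \<le> C / (1 + \<bar>x\<bar>)\<^sup>2"
    and "T > 0" "a \<le> b"
  shows "cmod (c1 - c2) * cmod (LINT x:{a..b}|lebesgue. \<alpha> x)
    \<le> cmod (LINT x|lebesgue. \<alpha> x * (P (T * (x - a)) - P (T * (x - b)))) + 2 * M * C * pi / T"
proof -
  let ?W = "\<lambda>x. P (T * (x - a)) - P (T * (x - b))"
  let ?q = "\<lambda>a x. 1 / (1 + (T * (x - a))\<^sup>2)"
  let ?E = "\<lambda>x. ?W x - (c1 - c2) * indicator {a..b} x"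
  have le: "C / (1 + \<bar>x\<bar>)\<^sup>2 \<le> C * (1 / (1 + x\<^sup>2))" for x :: real
  proof -
    have "1 + x\<^sup>2 \<le> (1 + \<bar>x\<bar>)\<^sup>2" by (simp add: power2_eq_square algebra_simps)
    moreover have "0 < 1 + x\<^sup>2" by (smt (verit) zero_le_power2)
    ultimately show ?thesis using \<open>C \<ge> 0\<close> by (simp add: frac_le)
  qed
  note c1' = order_trans[OF c1 le] and c2' = order_trans[OF c2 le]
  have E: "cmod (?E x) \<le> C * ?q a x + C * ?q b x" for x
  proof -
    have tri: "cmod (?W x - (c - c')) \<le> cmod (P (T * (x - a)) - c) + cmod (P (T * (x - b)) - c')" for c c'
      using norm_triangle_ineq4[of "P (T * (x - a)) - c" "P (T * (x - b)) - c'"] by (simp add: algebra_simps)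
    \<comment> \<open>The sign of each argument of \<open>P\<close> selects the limit to subtract:
      (c2, c2) left of the interval, (c1, c2) on it, (c1, c1) right of it. The difference of the
      pair is the value of the multiple of the indicator.\<close>
    consider "x < a" | "a \<le> x" "x \<le> b" | "b < x" by linarith
    then show ?thesis
    proof cases
      case 1
      then have "T * (x - a) \<le> 0" "T * (x - b) \<le> 0"
        using \<open>T > 0\<close> \<open>a \<le> b\<close> by (auto simp: mult_le_0_iff)
      then show ?thesis using tri[of c2 c2] c2'[of "T * (x - a)"] c2'[of "T * (x - b)"] 1 by simp
    next
      case 2
      then have "T * (x - a) \<ge> 0" "T * (x - b) \<le> 0"
        using \<open>T > 0\<close> by (auto simp: mult_le_0_iff)
      then show ?thesis using tri[of c1 c2] c1'[of "T * (x - a)"] c2'[of "T * (x - b)"] 2 by simp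
    next
      case 3
      then have "T * (x - a) \<ge> 0" "T * (x - b) \<ge> 0"
        using \<open>T > 0\<close> \<open>a \<le> b\<close> by auto
      then show ?thesis using tri[of c1 c1] c1'[of "T * (x - a)"] c1'[of "T * (x - b)"] 3 by simp
    qed
  qed
  have Wm: "?W \<in> borel_measurable lebesgue"
    by (intro measurable_completion) (auto intro!: borel_measurable_continuous_onI continuous_intros
        continuous_on_compose2[OF P])
  have Em: "?E \<in> borel_measurable lebesgue"
    by (rule borel_measurable_diff[OF Wm], rule borel_measurable_times[OF borel_measurable_const])
       (auto intro!: borel_measurable_indicator)
  have qi: "integrable lebesgue (\<lambda>x. M * (C * ?q a x + C * ?q b x))"
    using Cauchy_density_integral(1)[OF \<open>T > 0\<close>]
    by (intro integrable_mult_right Bochner_Integration.integrable_add) 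
  have bd: "AE x in lebesgue. norm (\<alpha> x * ?E x) \<le> M * (C * ?q a x + C * ?q b x)"
    using \<alpha>(2)
  proof eventually_elim
    case (elim x)
    then have "0 \<le> M" using norm_ge_zero order_trans by blast
    then show ?case unfolding norm_mult by (intro mult_mono elim E) auto
  qed
  have Ei: "integrable lebesgue (\<lambda>x. \<alpha> x * ?E x)"
  proof (rule Bochner_Integration.integrable_bound[OF qi])
    show "(\<lambda>x. \<alpha> x * ?E x) \<in> borel_measurable lebesgue"
      using \<alpha>(1) Em by (rule borel_measurable_times)
    show "AE x in lebesgue. norm (\<alpha> x * ?E x) \<le> norm (M * (C * ?q a x + C * ?q b x))"
      using bd by eventually_elim (erule order_trans, simp only: real_norm_def abs_ge_self)
  qed
  have "cmod (LINT x|lebesgue. \<alpha> x * ?E x) \<le> (LINT x|lebesgue. norm (\<alpha> x * ?E x))"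
    by (rule integral_norm_bound)
  also have "\<dots> \<le> (LINT x|lebesgue. M * (C * ?q a x + C * ?q b x))"
    using Ei qi bd by (intro integral_mono_AE) auto
  also have "\<dots> = M * (C * (pi / T) + C * (pi / T))"
    using Cauchy_density_integral[OF \<open>T > 0\<close>]
    by (simp only: integral_mult_right_zero Bochner_Integration.integral_add integrable_mult_right)
  also have "\<dots> = 2 * M * C * pi / T" by (simp add: field_simps)
  finally have small: "cmod (LINT x|lebesgue. \<alpha> x * ?E x) \<le> 2 * M * C * pi / T" .
  have Ii: "integrable lebesgue (\<lambda>x. (c1 - c2) * (indicator {a..b} x *\<^sub>R \<alpha> x))"
    using set_integrable_bounded[OF \<alpha>, of a b] by (intro integrable_mult_right) (simp add: set_integrable_def)
  have "(LINT x|lebesgue. \<alpha> x * ?W x) =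
      (LINT x|lebesgue. \<alpha> x * ?E x + (c1 - c2) * (indicator {a..b} x *\<^sub>R \<alpha> x))"
    by (intro Bochner_Integration.integral_cong) (auto simp: indicator_def algebra_simps)
  also have "\<dots> = (LINT x|lebesgue. \<alpha> x * ?E x) + (c1 - c2) * (LINT x:{a..b}|lebesgue. \<alpha> x)"
    by (simp only: set_lebesgue_integral_def Bochner_Integration.integral_add[OF Ei Ii]
        integral_mult_right_zero)
  finally have "(c1 - c2) * (LINT x:{a..b}|lebesgue. \<alpha> x) =
      (LINT x|lebesgue. \<alpha> x * ?W x) - (LINT x|lebesgue. \<alpha> x * ?E x)"
    by simp
  then have "cmod ((c1 - c2) * (LINT x:{a..b}|lebesgue. \<alpha> x)) \<le>
      cmod (LINT x|lebesgue. \<alpha> x * ?W x) + cmod (LINT x|lebesgue. \<alpha> x * ?E x)"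
    by (simp only: norm_triangle_ineq4)
  then show ?thesis using small by (simp only: norm_mult)
qed

subsection \<open>Oscillatory integrals of Sobolev functions\<close>

text \<open>The weak derivative takes the \<open>j\<close> derivatives off the test function; what
  remains is a sup norm of \<open>\<psi>\<close> against an L1 norm of \<open>v\<close>.\<close>

lemma weak_derivative_pairing:
  assumes v: "has_L1_deriv {a..b} j u v" and \<psi>: "\<psi> \<in> test_functions {a<..<b}"
    and B: "\<And>x. cmod (\<psi> x) \<le> B"
  shows "cmod (LINT x|lebesgue. u x * nth_deriv j \<psi> x) \<le> B * (LINT x:{a..b}|lebesgue. cmod (v x))"
proof -
  have "cmod (LINT x|lebesgue. u x * nth_deriv j \<psi> x) =
      cmod ((-1) ^ j * (LINT x|lebesgue. u x * nth_deriv j \<psi> x))"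
    by (simp add: norm_mult norm_power)
  also have "(-1) ^ j * (LINT x|lebesgue. u x * nth_deriv j \<psi> x) = (LINT x|lebesgue. v x * \<psi> x)"
    using v \<psi> by (simp add: has_L1_deriv_def distr_eq_on_def distr_deriv_def distr_of_def)
  also have "cmod (LINT x|lebesgue. v x * \<psi> x) \<le> B * (LINT x:{a..b}|lebesgue. cmod (v x))"
    using v B test_functions_zero_outside_Icc[OF \<psi>] continuous_on_smooth[OF test_functions_smooth[OF \<psi>]]
    by (intro integral_mult_bounded_support(2)) (auto simp: has_L1_deriv_def)
  finally show ?thesis .
qed

text \<open>As \<open>u\<close> has only weak derivatives, powers of s are gained on the test
  function: is g e = (g e)' - g' e for the wave e. Each step either raises \<open>j\<close> or
  differentiates \<open>g\<close>, which doubles the number of terms and gives \<open>2 ^ m\<close>.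
  The order \<open>j\<close> is general for the induction.\<close>

lemma weak_oscillation_bound:
  assumes u: "u absolutely_integrable_on {a..b}"
    and v: "\<And>j. j \<le> l \<Longrightarrow> has_L1_deriv {a..b} j u (v j)"
    and V: "\<And>j. j \<le> l \<Longrightarrow> (LINT x:{a..b}|lebesgue. cmod (v j x)) \<le> V"
    and g: "g \<in> test_functions {a<..<b}" and B: "\<And>i x. i \<le> m \<Longrightarrow> cmod (nth_deriv i g x) \<le> B"
    and "j + m \<le> l" "B \<ge> 0"
  shows "\<bar>s\<bar> ^ m * cmod (LINT x|lebesgue. u x * nth_deriv j (\<lambda>x. g x * exp (\<i> * of_real (s * x))) x)
    \<le> 2 ^ m * B * V"
  using g B \<open>j + m \<le> l\<close>
proof (induction m arbitrary: j g)
  case 0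
  let ?\<psi> = "\<lambda>x. g x * exp (\<i> * of_real (s * x))"
  have "cmod (LINT x|lebesgue. u x * nth_deriv j ?\<psi> x) \<le> B * (LINT x:{a..b}|lebesgue. cmod (v j x))"
  proof (rule weak_derivative_pairing)
    show "has_L1_deriv {a..b} j u (v j)" using v 0 by simp
    show "?\<psi> \<in> test_functions {a<..<b}" by (intro test_functions_mult smooth_exp_wave 0)
    show "cmod (?\<psi> x) \<le> B" for x using 0(2)[of 0] by (simp add: norm_mult)
  qed
  also have "\<dots> \<le> B * V"
    using V[of j] 0 \<open>B \<ge> 0\<close> by (intro mult_left_mono) auto
  finally show ?case by simp
next
  case (Suc m)
  let ?e = "\<lambda>x. exp (\<i> * of_real (s * x))"
  let ?I = "\<lambda>j g. LINT x|lebesgue. u x * nth_deriv j (\<lambda>x. g x * ?e x) x"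
  have t: "(\<lambda>x. h x * ?e x) \<in> test_functions {a<..<b}" if "h \<in> test_functions {a<..<b}" for h
    by (intro test_functions_mult smooth_exp_wave that)
  have int: "integrable lebesgue (\<lambda>x. u x * nth_deriv j (\<lambda>x. h x * ?e x) x)"
    if "h \<in> test_functions {a<..<b}" for h j
  proof -
    have t': "nth_deriv j (\<lambda>x. h x * ?e x) \<in> test_functions {a<..<b}"
      by (rule test_functions_nth_deriv[OF t[OF that]])
    obtain R where "\<And>x. cmod (nth_deriv j (\<lambda>x. h x * ?e x) x) \<le> R"
      using test_functions_bounded[OF t'] by blast
    then show ?thesis
      using test_functions_zero_outside_Icc[OF t'] continuous_on_smooth[OF test_functions_smooth[OF t']]
      by (intro integral_mult_bounded_support(1)[OF u]) auto
  qed
  have sm: "smooth_on UNIV (\<lambda>x. g x * ?e x)" "smooth_on UNIV (\<lambda>x. nth_deriv 1 g x * ?e x)"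
    using t Suc.prems(1) test_functions_nth_deriv[OF Suc.prems(1)] test_functions_smooth by blast+
  have d1: "nth_deriv 1 (\<lambda>x. g x * ?e x) = (\<lambda>x. nth_deriv 1 g x * ?e x + (\<i> * of_real s) * (g x * ?e x))"
  proof -
    have "nth_deriv 1 (\<lambda>x. g x * ?e x) = (\<lambda>x. g x * (\<i> * of_real s * ?e x) + nth_deriv 1 g x * ?e x)"
      by (rule nth_deriv_1_eqI, rule has_vector_derivative_mult,
          rule smooth_has_vector_derivative[OF test_functions_smooth[OF Suc.prems(1)]],
          rule vector_derivative_exp_wave)
    then show ?thesis by (simp add: algebra_simps)
  qed
  have "nth_deriv (Suc j) (\<lambda>x. g x * ?e x) = nth_deriv j (nth_deriv 1 (\<lambda>x. g x * ?e x))"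
    by (simp add: nth_deriv_nth_deriv)
  also have "\<dots> = (\<lambda>x. nth_deriv j (\<lambda>x. nth_deriv 1 g x * ?e x) x + (\<i> * of_real s) * nth_deriv j (\<lambda>x. g x * ?e x) x)"
    unfolding d1 by (subst nth_deriv_add[OF sm(2) smooth_cmult[OF sm(1)]], subst nth_deriv_cmult[OF sm(1)], rule refl)
  finally have eq: "(\<i> * of_real s) * (u x * nth_deriv j (\<lambda>x. g x * ?e x) x) =
      u x * nth_deriv (Suc j) (\<lambda>x. g x * ?e x) x - u x * nth_deriv j (\<lambda>x. nth_deriv 1 g x * ?e x) x" for x
    by (simp add: algebra_simps)
  have "(\<i> * of_real s) * ?I j g = (LINT x|lebesgue. (\<i> * of_real s) * (u x * nth_deriv j (\<lambda>x. g x * ?e x) x))"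
    by simp
  also have "\<dots> = ?I (Suc j) g - ?I j (nth_deriv 1 g)"
    unfolding eq
    by (rule Bochner_Integration.integral_diff[OF int int]) (use Suc.prems(1) test_functions_nth_deriv in auto)
  finally have "cmod ((\<i> * of_real s) * ?I j g) = cmod (?I (Suc j) g - ?I j (nth_deriv 1 g))"
    by (rule arg_cong)
  then have "\<bar>s\<bar> * cmod (?I j g) = cmod (?I (Suc j) g - ?I j (nth_deriv 1 g))"
    unfolding norm_mult norm_ii norm_of_real mult_1 .
  then have "\<bar>s\<bar> ^ Suc m * cmod (?I j g) = \<bar>s\<bar> ^ m * cmod (?I (Suc j) g - ?I j (nth_deriv 1 g))"
    by (simp only: power_Suc2 mult.assoc)
  also have "\<dots> \<le> \<bar>s\<bar> ^ m * (cmod (?I (Suc j) g) + cmod (?I j (nth_deriv 1 g)))"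
    by (intro mult_left_mono norm_triangle_ineq4) auto
  also have "\<dots> = \<bar>s\<bar> ^ m * cmod (?I (Suc j) g) + \<bar>s\<bar> ^ m * cmod (?I j (nth_deriv 1 g))"
    by (rule distrib_left)
  also have "\<dots> \<le> 2 ^ m * B * V + 2 ^ m * B * V"
  proof (rule add_mono)
    show "\<bar>s\<bar> ^ m * cmod (?I (Suc j) g) \<le> 2 ^ m * B * V"
      using Suc.prems by (intro Suc.IH) auto
    show "\<bar>s\<bar> ^ m * cmod (?I j (nth_deriv 1 g)) \<le> 2 ^ m * B * V"
    proof (rule Suc.IH)
      show "nth_deriv 1 g \<in> test_functions {a<..<b}"
        by (rule test_functions_nth_deriv[OF Suc.prems(1)])
      show "cmod (nth_deriv i (nth_deriv 1 g) x) \<le> B" if "i \<le> m" for i x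
        using Suc.prems(2)[of "Suc i" x] that by (simp add: nth_deriv_nth_deriv)
      show "j + m \<le> l" using Suc.prems(3) by simp
    qed
  qed
  also have "\<dots> = 2 ^ Suc m * B * V"
    by simp
  finally show ?case .
qed

lemma sobolev1_norm_ge:
  assumes "j \<le> l"
  shows "(LINT x:I|lebesgue. cmod ((SOME v. has_L1_deriv I j u v) x)) \<le> sobolev1_norm l I u"
  unfolding sobolev1_norm_def
proof (rule member_le_sum)
  show "0 \<le> (LINT x:I|lebesgue. cmod ((SOME v. has_L1_deriv I i u v) x))" for i
    by (auto simp: set_lebesgue_integral_def intro!: integral_nonneg)
qed (use assms in auto)

lemma test_functions_derivs_bounded:
  assumes "\<phi> \<in> test_functions U"
  obtains B where "B \<ge> 0" "\<And>i x. i \<le> l \<Longrightarrow> cmod (nth_deriv i \<phi> x) \<le> B"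
proof -
  have "\<exists>B. \<forall>x. cmod (nth_deriv i \<phi> x) \<le> B" for i
    using test_functions_bounded[OF test_functions_nth_deriv[OF assms]] by metis
  then obtain B where B: "\<And>i x. cmod (nth_deriv i \<phi> x) \<le> B i" by metis
  then have nn: "B i \<ge> 0" for i using norm_ge_zero order_trans by blast
  have "cmod (nth_deriv i \<phi> x) \<le> sum B {..l}" if "i \<le> l" for i x
    using order_trans[OF B[of i x] member_le_sum[of i "{..l}" B]] nn that by simp
  then show thesis using that[of "sum B {..l}"] nn by (simp add: sum_nonneg)
qed

section \<open>Averages of \<alpha> over intervals, and passage to point values\<close>

text \<open>The point is the uniformity of \<open>K\<close> in \<open>T\<close>,
  \<open>\<Sigma>\<close>, \<open>a\<close> and \<open>b\<close>: for T \<ge> 1 the rescaled cutoff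
  has derivatives no larger than those of \<rho>, and the gain from frequencies at least \<Sigma>/2
  is matched exactly by the condition on the Sobolev norm.\<close>

lemma average_bound:
  fixes \<alpha> u :: "real \<Rightarrow> complex"
  assumes \<alpha>: "\<alpha> \<in> borel_measurable lebesgue" "AE x in lebesgue. cmod (\<alpha> x) \<le> M"
    and u: "u \<in> sobolev1_loc l"
    and eq: "distr_eq_on UNIV (distr_fourier (distr_of \<alpha>)) (distr_of (\<lambda>\<tau>. of_real \<tau> * u \<tau>))"
  obtains K where
    "\<And>T \<Sigma> a b. T \<ge> 1 \<Longrightarrow> \<Sigma> > 0 \<Longrightarrow> \<Sigma> / 2 \<le> a \<Longrightarrow> a \<le> b \<Longrightarrow> T * sobolev1_norm l {-T..T} u \<le> \<Sigma> ^ l \<Longrightarrow>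
      cmod (LINT x:{a..b}|lebesgue. \<alpha> x) \<le> K / T"
proof -
  obtain \<rho> P c1 c2 C where \<rho>: "\<rho> \<in> test_functions {-1<..<1}"
    and P: "\<And>x. (P has_vector_derivative fourier \<rho> x) (at x)" and c: "c1 \<noteq> c2" and "C \<ge> 0"
    and c1: "\<And>x. x \<ge> 0 \<Longrightarrow> cmod (P x - c1) \<le> C / (1 + \<bar>x\<bar>)\<^sup>2"
    and c2: "\<And>x. x \<le> 0 \<Longrightarrow> cmod (P x - c2) \<le> C / (1 + \<bar>x\<bar>)\<^sup>2"
    using kernel_exists by blast
  have Pc: "continuous_on UNIV P"
    using P by (meson continuous_at_imp_continuous_on has_vector_derivative_continuous)
  obtain B where "B \<ge> 0" and B: "\<And>i x. i \<le> l \<Longrightarrow> cmod (nth_deriv i \<rho> x) \<le> B"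
    using test_functions_derivs_bounded[OF \<rho>] by blast
  \<comment> \<open>The first summand collects the waves at \<open>a\<close> and \<open>b\<close>;
    one \<open>2 ^ l\<close> counts the terms of the integrations by parts, the other comes from
    frequencies being at least \<Sigma>/2. The second is the kernel error.\<close>
  define K where "K = (2 * (2 ^ l * B * 2 ^ l) + 2 * M * C * pi) / cmod (c1 - c2)"
  have "cmod (LINT x:{a..b}|lebesgue. \<alpha> x) \<le> K / T"
    if "T \<ge> 1" "\<Sigma> > 0" "\<Sigma> / 2 \<le> a" "a \<le> b" and T\<Sigma>: "T * sobolev1_norm l {-T..T} u \<le> \<Sigma> ^ l" for T \<Sigma> a b
  proof -
    define V where "V = sobolev1_norm l {-T..T} u"
    let ?g = "\<lambda>\<tau>. \<rho> (\<tau> / T)"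
    let ?e = "\<lambda>s \<tau>. exp (\<i> * of_real (s * \<tau>))"
    have "T > 0" using \<open>T \<ge> 1\<close> by simp
    have g: "?g \<in> test_functions {-T<..<T}"
      using test_functions_scale[OF \<rho> \<open>T > 0\<close>] .
    have "u \<in> sobolev1 l {-T..T}"
      using u \<open>T > 0\<close> by (simp add: sobolev1_loc_def)
    then have ui: "u absolutely_integrable_on {-T..T}"
      and ex: "\<And>j. j \<le> l \<Longrightarrow> \<exists>v. has_L1_deriv {-T..T} j u v"
      by (auto simp: sobolev1_def)
    have v: "has_L1_deriv {-T..T} j u (SOME v. has_L1_deriv {-T..T} j u v)" if "j \<le> l" for j
      using ex[OF that] by (rule someI_ex)
    have gB: "cmod (nth_deriv i ?g x) \<le> B" if "i \<le> l" for i x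
    proof -
      have "nth_deriv i ?g = (\<lambda>x. of_real (1 / T) ^ i * nth_deriv i \<rho> (1 / T * x))"
        using nth_deriv_scale[OF test_functions_smooth[OF \<rho>], of i "1 / T"] by simp
      then have "cmod (nth_deriv i ?g x) = (1 / T) ^ i * cmod (nth_deriv i \<rho> (1 / T * x))"
        using \<open>T > 0\<close> by (simp add: norm_mult norm_power norm_divide)
      also have "\<dots> \<le> 1 * B"
        using \<open>T \<ge> 1\<close> B[OF that] by (intro mult_mono power_le_one) auto
      finally show ?thesis by simp
    qed
    have osc: "cmod (LINT x|lebesgue. u x * (?g x * ?e s x)) \<le> 2 ^ l * B * 2 ^ l / T" if "\<Sigma> / 2 \<le> s" for s
    proof -
      \<comment> \<open>The case j = 0, m = l, where all available weak derivatives are spent on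
        powers of s.\<close>
      have "\<bar>s\<bar> ^ l * cmod (LINT x|lebesgue. u x * nth_deriv 0 (\<lambda>x. ?g x * ?e s x) x) \<le> 2 ^ l * B * V"
        unfolding V_def
      proof (rule weak_oscillation_bound[OF ui v _ g _ _ \<open>B \<ge> 0\<close>])
        show "(LINT x:{-T..T}|lebesgue. cmod ((SOME v. has_L1_deriv {-T..T} j u v) x)) \<le> sobolev1_norm l {-T..T} u"
          if "j \<le> l" for j
          using that by (rule sobolev1_norm_ge)
        show "cmod (nth_deriv i ?g x) \<le> B" if "i \<le> l" for i x
          using that by (rule gB)
      qed simp_all
      moreover have "(\<Sigma> / 2) ^ l \<le> \<bar>s\<bar> ^ l"
        using that \<open>\<Sigma> > 0\<close> by (intro power_mono) auto
      ultimately have "(\<Sigma> / 2) ^ l * cmod (LINT x|lebesgue. u x * (?g x * ?e s x)) \<le> 2 ^ l * B * V"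
        unfolding nth_deriv_0 using order_trans[OF mult_right_mono[OF _ norm_ge_zero]] by blast
      then have "\<Sigma> ^ l * cmod (LINT x|lebesgue. u x * (?g x * ?e s x)) \<le> 2 ^ l * B * 2 ^ l * V"
        by (simp add: power_divide field_simps)
      \<comment> \<open>Here the condition on \<open>T\<close> enters as V \<le> \<Sigma>^l / T, so
        that the powers of \<Sigma> cancel and 1/T remains.\<close>
      moreover have "2 ^ l * B * 2 ^ l * V \<le> 2 ^ l * B * 2 ^ l * (\<Sigma> ^ l / T)"
        using T\<Sigma> \<open>B \<ge> 0\<close> \<open>T > 0\<close> by (intro mult_left_mono) (auto simp: V_def field_simps)
      ultimately have "\<Sigma> ^ l * cmod (LINT x|lebesgue. u x * (?g x * ?e s x)) \<le> \<Sigma> ^ l * (2 ^ l * B * 2 ^ l / T)"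
        by (simp add: mult_ac)
      then show ?thesis
        using \<open>\<Sigma> > 0\<close> by (rule mult_left_le_imp_le[OF _ zero_less_power])
    qed
    have int: "integrable lebesgue (\<lambda>x. u x * (?g x * ?e s x))" for s
    proof -
      have t: "(\<lambda>x. ?g x * ?e s x) \<in> test_functions {-T<..<T}"
        by (intro test_functions_mult smooth_exp_wave g)
      obtain R where "\<And>x. cmod (?g x * ?e s x) \<le> R"
        using test_functions_bounded[OF t] by blast
      then show ?thesis
        using test_functions_zero_outside_Icc[OF t] continuous_on_smooth[OF test_functions_smooth[OF t]]
        by (intro integral_mult_bounded_support(1)[OF ui]) auto
    qed
    have t: "(\<lambda>\<tau>. ?g \<tau> * band a b \<tau>) \<in> test_functions UNIV"
      using test_functions_mult[OF g smooth_band] test_functions_mono[of _ UNIV] by blast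
    have "(LINT x|lebesgue. \<alpha> x * (P (T * (x - a)) - P (T * (x - b)))) =
        (LINT \<tau>|lebesgue. of_real \<tau> * u \<tau> * (?g \<tau> * band a b \<tau>))"
      using bspec[OF eq[unfolded distr_eq_on_def] t]
      by (simp only: distr_fourier_def distr_of_def fourier_band[OF \<rho> \<open>T > 0\<close> \<open>a \<le> b\<close> P])
    also have "\<dots> = (LINT \<tau>|lebesgue. - \<i> * (u \<tau> * (?g \<tau> * ?e b \<tau>) - u \<tau> * (?g \<tau> * ?e a \<tau>)))"
    proof (rule Bochner_Integration.integral_cong[OF refl])
      fix \<tau>
      have "of_real \<tau> * u \<tau> * (?g \<tau> * band a b \<tau>) = - \<i> * (u \<tau> * ?g \<tau>) * (\<i> * of_real \<tau> * band a b \<tau>)"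
        by (simp add: mult_ac)
      also have "\<dots> = - \<i> * (u \<tau> * (?g \<tau> * ?e b \<tau>) - u \<tau> * (?g \<tau> * ?e a \<tau>))"
        unfolding band_mult_frequency[OF \<open>a \<le> b\<close>] by (simp add: algebra_simps)
      finally show "of_real \<tau> * u \<tau> * (?g \<tau> * band a b \<tau>) = \<dots>" .
    qed
    also have "\<dots> = - \<i> * ((LINT \<tau>|lebesgue. u \<tau> * (?g \<tau> * ?e b \<tau>)) - (LINT \<tau>|lebesgue. u \<tau> * (?g \<tau> * ?e a \<tau>)))"
      by (simp only: integral_mult_right_zero Bochner_Integration.integral_diff[OF int int])
    finally have "cmod (LINT x|lebesgue. \<alpha> x * (P (T * (x - a)) - P (T * (x - b)))) =
        cmod ((LINT \<tau>|lebesgue. u \<tau> * (?g \<tau> * ?e b \<tau>)) - (LINT \<tau>|lebesgue. u \<tau> * (?g \<tau> * ?e a \<tau>)))"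
      by (simp only: norm_mult norm_minus_cancel norm_ii mult_1)
    also have "\<dots> \<le> 2 ^ l * B * 2 ^ l / T + 2 ^ l * B * 2 ^ l / T"
      using osc[of a] osc[of b] that by (intro order_trans[OF norm_triangle_ineq4] add_mono) auto
    finally have "cmod (c1 - c2) * cmod (LINT x:{a..b}|lebesgue. \<alpha> x) \<le>
        2 ^ l * B * 2 ^ l / T + 2 ^ l * B * 2 ^ l / T + 2 * M * C * pi / T"
      using average_le_kernel[OF \<alpha> Pc \<open>C \<ge> 0\<close> c1 c2 \<open>T > 0\<close> \<open>a \<le> b\<close>] by linarith
    then show ?thesis
      using c \<open>T > 0\<close> by (simp add: K_def field_simps)
  qed
  then show thesis using that by blast
qed

text \<open>
  If \<open>f\<close> cannot fall faster than linearly, a value \<open>f \<Sigma> = \<delta> > 0\<close> forces \<open>f \<ge> \<delta> / 2\<close> on an interval of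
  length \<open>\<delta> / (2 L)\<close> to the right of \<open>\<Sigma>\<close>; a negative value is treated on the left.
\<close>

lemma one_sided_tauberian:
  fixes f :: "real \<Rightarrow> real"
  assumes "L > 0" "x0 \<ge> 1" "\<Sigma> \<ge> 2 * x0"
    and bounded: "\<And>x. x \<ge> x0 \<Longrightarrow> \<bar>f x\<bar> \<le> L"
    and slope: "\<And>x y. x0 \<le> x \<Longrightarrow> x \<le> y \<Longrightarrow> y \<le> x + 1 \<Longrightarrow> f x - L * (y - x) \<le> f y"
    and int: "\<And>a b. set_integrable lebesgue {a..b} f"
    and avg: "\<And>a b. \<Sigma> / 2 \<le> a \<Longrightarrow> a \<le> b \<Longrightarrow> \<bar>LINT x:{a..b}|lebesgue. f x\<bar> \<le> \<kappa>"
  shows "(f \<Sigma>)\<^sup>2 \<le> 4 * L * \<kappa>"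
proof -
  \<comment> \<open>On a length \<open>r\<close> a decline at slope \<open>L\<close> uses up half of
    the value at \<Sigma>. Since r \<le> 1/2 and \<Sigma> \<ge> 2 * x0 \<ge> 2, the intervals on
    both sides stay within reach of \<open>slope\<close> and to the right of \<Sigma>/2.\<close>
  define r where "r = \<bar>f \<Sigma>\<bar> / (2 * L)"
  have r: "0 \<le> r" "r \<le> 1 / 2" "L * r = \<bar>f \<Sigma>\<bar> / 2"
    using bounded[of \<Sigma>] assms(1-3) by (auto simp: r_def field_simps)
  have const: "set_integrable lebesgue {a..b} (\<lambda>x. c)" "(LINT x:{a..b}|lebesgue. c) = c * (b - a)"
    if "a \<le> b" for a b c :: real
  proof -
    show i: "set_integrable lebesgue {a..b} (\<lambda>x. c)"
      by (intro absolutely_integrable_continuous_real continuous_intros)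
    show "(LINT x:{a..b}|lebesgue. c) = c * (b - a)"
      using set_lebesgue_integral_eq_integral(2)[OF i] that by simp
  qed
  \<comment> \<open>Height times width of the forced rectangle is the square of the value divided by
    4 L.\<close>
  have "\<bar>f \<Sigma>\<bar> / 2 * r \<le> \<kappa>"
  proof (cases "f \<Sigma> \<ge> 0")
    case True
    have "\<bar>f \<Sigma>\<bar> / 2 * r = (LINT x:{\<Sigma>..\<Sigma>+r}|lebesgue. \<bar>f \<Sigma>\<bar> / 2)"
      using const[of \<Sigma> "\<Sigma> + r"] r by simp
    also have "\<dots> \<le> (LINT x:{\<Sigma>..\<Sigma>+r}|lebesgue. f x)"
    proof (rule set_integral_mono[OF const(1) int])
      fix x assume x: "x \<in> {\<Sigma>..\<Sigma>+r}"
      then have "f \<Sigma> - L * (x - \<Sigma>) \<le> f x"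
        using r assms(2,3) by (intro slope) auto
      moreover have "L * (x - \<Sigma>) \<le> L * r"
        using x \<open>L > 0\<close> by (intro mult_left_mono) auto
      ultimately show "\<bar>f \<Sigma>\<bar> / 2 \<le> f x" using r True by simp
    qed (use r in auto)
    also have "\<dots> \<le> \<kappa>"
      using avg[of \<Sigma> "\<Sigma> + r"] r assms(2,3) by auto
    finally show ?thesis .
  next
    case False
    have "(LINT x:{\<Sigma>-r..\<Sigma>}|lebesgue. f x) \<le> (LINT x:{\<Sigma>-r..\<Sigma>}|lebesgue. - \<bar>f \<Sigma>\<bar> / 2)"
    proof (rule set_integral_mono[OF int const(1)])
      fix x assume x: "x \<in> {\<Sigma>-r..\<Sigma>}"
      then have "f x - L * (\<Sigma> - x) \<le> f \<Sigma>"
        using r assms(2,3) by (intro slope) auto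
      moreover have "L * (\<Sigma> - x) \<le> L * r"
        using x \<open>L > 0\<close> by (intro mult_left_mono) auto
      ultimately show "f x \<le> - \<bar>f \<Sigma>\<bar> / 2" using r False by simp
    qed (use r in auto)
    also have "\<dots> = - (\<bar>f \<Sigma>\<bar> / 2 * r)"
      using const(2)[of "\<Sigma> - r" \<Sigma> "- \<bar>f \<Sigma>\<bar> / 2"] r by simp
    finally show ?thesis
      using avg[of "\<Sigma> - r" \<Sigma>] r assms(2,3) by auto
  qed
  then show ?thesis
    using \<open>L > 0\<close> by (simp add: r_def field_simps power2_eq_square abs_mult_self_eq)
qed

subsection \<open>Regularity of the rescaled remainder\<close>

lemma bracket_ge_1: "1 \<le> bracket x"
  by (simp add: bracket_def)

lemma bracket_ge_abs: "\<bar>x\<bar> \<le> bracket x"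
  unfolding bracket_def by (rule real_le_rsqrt) simp

lemma bracket_mono: "\<bar>x\<bar> \<le> \<bar>y\<bar> \<Longrightarrow> bracket x \<le> bracket y"
  by (simp add: bracket_def abs_le_square_iff)

text \<open>Moving by one unit costs only a constant factor, which pays for replacing a point by a
  nearby one where \<alpha> is known to be bounded.\<close>

lemma bracket_le_double:
  assumes "\<bar>y\<bar> \<le> \<bar>x\<bar> + 1"
  shows "bracket y \<le> 2 * bracket x"
proof -
  have "bracket y \<le> sqrt ((2 * bracket x)\<^sup>2)"
    unfolding bracket_def
  proof (rule real_sqrt_le_mono)
    have "y\<^sup>2 \<le> (\<bar>x\<bar> + 1)\<^sup>2"
      using power_mono[OF assms abs_ge_zero, of 2] by simp
    also have "\<dots> \<le> 2 * x\<^sup>2 + 2"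
      using sum_squares_bound[of "\<bar>x\<bar>" 1] by (simp add: power2_eq_square algebra_simps)
    finally have "1 + y\<^sup>2 \<le> 3 + 2 * x\<^sup>2"
      by simp
    also have "\<dots> \<le> 4 * (1 + x\<^sup>2)"
      using zero_le_power2[of x] by (simp add: distrib_left)
    finally show "1 + y\<^sup>2 \<le> (2 * sqrt (1 + x\<^sup>2))\<^sup>2"
      by (simp add: power_mult_distrib)
  qed
  then show ?thesis
    using bracket_ge_1[of x] by (simp add: real_sqrt_mult)
qed

lemma bracket_powi_has_derivative:
  "((\<lambda>x. bracket x powi k) has_real_derivative of_int k * bracket x powi (k - 1) * (x / bracket x)) (at x)"
proof -
  have pos: "1 + x\<^sup>2 > 0" by (smt (verit) zero_le_power2)
  have "((\<lambda>x. 1 + x\<^sup>2) has_real_derivative 2 * x) (at x)"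
    by (auto intro!: derivative_eq_intros)
  note * = DERIV_chain2[OF DERIV_real_sqrt[OF pos] this]
  have "(bracket has_real_derivative x / bracket x) (at x)"
    unfolding bracket_def by (rule DERIV_cong[OF *]) (simp add: field_simps)
  from DERIV_power_int[OF this, of k] show ?thesis
    using bracket_ge_1[of x] by simp
qed

lemma bracket_powi_deriv_bound:
  "\<bar>of_int k * bracket x powi (k - 1) * (x / bracket x)\<bar> \<le> \<bar>of_int k\<bar> * bracket x powi (k - 1)"
proof -
  have "\<bar>x / bracket x\<bar> \<le> 1"
    using bracket_ge_1[of x] bracket_ge_abs[of x] by (simp add: divide_le_eq)
  moreover have "0 \<le> bracket x powi (k - 1)"
    using bracket_ge_1[of x] by simp
  ultimately show ?thesis
    using mult_left_mono[of "\<bar>x / bracket x\<bar>" 1 "\<bar>of_int k\<bar> * bracket x powi (k - 1)"]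
    by (simp add: abs_mult)
qed

lemma poly_le_bracket:
  obtains C where "C \<ge> 0" "\<And>x. cmod (poly Z (of_real x)) \<le> C * bracket x ^ degree Z"
proof
  let ?C = "\<Sum>i\<le>degree Z. cmod (coeff Z i)"
  show "?C \<ge> 0" by (simp add: sum_nonneg)
  show "cmod (poly Z (of_real x)) \<le> ?C * bracket x ^ degree Z" for x
  proof -
    have "cmod (poly Z (of_real x)) \<le> (\<Sum>i\<le>degree Z. cmod (coeff Z i) * \<bar>x\<bar> ^ i)"
      unfolding poly_altdef by (rule order_trans[OF norm_sum]) (simp add: norm_mult norm_power)
    also have "\<dots> \<le> (\<Sum>i\<le>degree Z. cmod (coeff Z i) * bracket x ^ degree Z)"
    proof (rule sum_mono, rule mult_left_mono)
      fix i assume "i \<in> {..degree Z}"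
      have "\<bar>x\<bar> ^ i \<le> bracket x ^ i"
        by (intro power_mono bracket_ge_abs) auto
      also have "\<dots> \<le> bracket x ^ degree Z"
        using \<open>i \<in> {..degree Z}\<close> by (intro power_increasing bracket_ge_1) auto
      finally show "\<bar>x\<bar> ^ i \<le> bracket x ^ degree Z" .
    qed auto
    also have "\<dots> = ?C * bracket x ^ degree Z"
      by (rule sum_distrib_right[symmetric])
    finally show ?thesis .
  qed
qed

text \<open>The weight of order 1 - d makes both terms of the product rule have order 0: it meets Z'
  of order d - 1, and its derivative of order -d meets Z of order d.\<close>

lemma rescaled_poly_lipschitz:
  obtains L where "L \<ge> 0"
    "\<And>x y. x \<le> y \<Longrightarrow> cmod (of_real (bracket y powi (1 - int (degree Z))) * poly Z (of_real y)
        - of_real (bracket x powi (1 - int (degree Z))) * poly Z (of_real x)) \<le> L * (y - x)"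
proof -
  define k where "k = 1 - int (degree Z)"
  let ?w = "\<lambda>x. bracket x powi k"
  let ?w' = "\<lambda>x. of_int k * bracket x powi (k - 1) * (x / bracket x)"
  let ?g = "\<lambda>x. of_real (?w x) * poly Z (of_real x)"
  let ?g' = "\<lambda>x. of_real (?w x) * poly (pderiv Z) (of_real x) + of_real (?w' x) * poly Z (of_real x)"
  obtain C where C: "C \<ge> 0" "\<And>x. cmod (poly Z (of_real x)) \<le> C * bracket x ^ degree Z"
    using poly_le_bracket[of Z] by blast
  obtain C' where C': "C' \<ge> 0" "\<And>x. cmod (poly (pderiv Z) (of_real x)) \<le> C' * bracket x ^ degree (pderiv Z)"
    using poly_le_bracket[of "pderiv Z"] by blast
  define L where "L = C' + \<bar>of_int k\<bar> * C"
  have deriv: "(?g has_vector_derivative ?g' x) (at x)" for x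
    by (intro has_vector_derivative_mult has_vector_derivative_of_real bracket_powi_has_derivative
        has_vector_derivative_real_field poly_DERIV)
  have pos: "bracket x > 0" for x using bracket_ge_1[of x] by linarith
  have bound: "cmod (?g' x) \<le> L" for x
  proof -
    have 1: "cmod (of_real (?w x) * poly (pderiv Z) (of_real x)) \<le> C'"
    \<comment> \<open>For constant \<open>Z\<close> the degree of \<open>pderiv Z\<close> is 0 and
      not -1, so the powers would not cancel; there the derivative itself is 0.\<close>
    proof (cases "degree Z = 0")
      case True
      then have "pderiv Z = 0" by (simp add: pderiv_eq_0_iff)
      then show ?thesis using C' by simp
    next
      case False
      then have "bracket x powi k * bracket x ^ degree (pderiv Z) = 1"
        using pos[of x] by (simp add: k_def degree_pderiv power_int_diff field_simps flip: power_Suc)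
      moreover have "cmod (of_real (?w x) * poly (pderiv Z) (of_real x)) \<le>
          bracket x powi k * (C' * bracket x ^ degree (pderiv Z))"
        unfolding norm_mult norm_of_real using C'(2)[of x] pos[of x] by (intro mult_mono) auto
      ultimately show ?thesis by (simp add: mult.left_commute)
    qed
    have "cmod (of_real (?w' x) * poly Z (of_real x)) \<le>
        (\<bar>of_int k\<bar> * bracket x powi (k - 1)) * (C * bracket x ^ degree Z)"
      unfolding norm_mult norm_of_real
      using C by (intro mult_mono bracket_powi_deriv_bound) (use pos[of x] in auto)
    also have "\<dots> = \<bar>of_int k\<bar> * C * (bracket x powi (k - 1) * bracket x ^ degree Z)"
      by (simp add: mult_ac)
    also have "bracket x powi (k - 1) * bracket x ^ degree Z = 1"
      using pos[of x] by (simp add: k_def power_int_minus)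
    finally have "cmod (of_real (?w' x) * poly Z (of_real x)) \<le> \<bar>of_int k\<bar> * C" by simp
    with 1 show ?thesis
      unfolding L_def by (intro order_trans[OF norm_triangle_ineq] add_mono)
  qed
  have "cmod (?g y - ?g x) \<le> L * (y - x)" if "x \<le> y" for x y
  proof (cases "x = y")
    case False
    have "cmod (?g y - ?g x) \<le> L * y - L * x"
    proof (rule differentiable_bound_general[of x y ?g "\<lambda>t. L * t" ?g' "\<lambda>_. L"])
      show "continuous_on {x..y} ?g"
        using deriv by (meson continuous_at_imp_continuous_on has_vector_derivative_continuous)
      show "((\<lambda>t. L * t) has_vector_derivative L) (at t)" for t
        by (simp flip: has_real_derivative_iff_has_vector_derivative)
    qed (use that False deriv bound in \<open>auto intro!: continuous_intros\<close>)
    then show ?thesis by (simp add: algebra_simps)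
  qed simp
  moreover have "L \<ge> 0" using C C' by (simp add: L_def)
  ultimately show thesis using that by (simp add: k_def)
qed

section \<open>From almost everywhere bounds to pointwise bounds\<close>

text \<open>An interval of positive length is not a null set. This supplies a good point within
  distance 1 of any given point.\<close>

lemma AE_lebesgue_Icc_ex:
  assumes "AE x in lebesgue. Q x" "a < (b::real)"
  obtains x where "x \<in> {a..b}" "Q x"
proof -
  have "\<not> (AE x in lebesgue. x \<notin> {a..b})"
  proof
    assume "AE x in lebesgue. x \<notin> {a..b}"
    then have "emeasure lebesgue {a..b} = 0"
      by (subst (asm) AE_iff_measurable[of "{a..b}"]) auto
    then show False using \<open>a < b\<close> by simp
  qed
  then have "\<exists>x. \<not> (Q x \<longrightarrow> x \<notin> {a..b})"
    using assms(1) by (metis (mono_tags, lifting) AE_mp AE_I2)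
  then show thesis using that by blast
qed

text \<open>A good point in [x, x + 1] bounds \<open>f x\<close> from above and one in [x - 1, x]
  from below; the slope condition loses at most \<open>L\<close> on the way. The left interval
  explains the shift in \<open>x0 + 1\<close>.\<close>

lemma slope_bounded:
  fixes f :: "real \<Rightarrow> real"
  assumes AE: "AE x in lebesgue. \<bar>f x\<bar> \<le> M" and "L \<ge> 0"
    and slope: "\<And>x y. x0 \<le> x \<Longrightarrow> x \<le> y \<Longrightarrow> y \<le> x + 1 \<Longrightarrow> f x - L * (y - x) \<le> f y"
    and "x \<ge> x0 + 1"
  shows "\<bar>f x\<bar> \<le> M + L"
proof -
  have L: "L * t \<le> L" if "t \<le> 1" for t
    using mult_left_mono[OF that \<open>L \<ge> 0\<close>] by simp
  obtain y where "y \<in> {x..x+1}" "\<bar>f y\<bar> \<le> M" using AE_lebesgue_Icc_ex[OF AE, of x "x + 1"] by auto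
  then have "f x \<le> M + L" using slope[of x y] L[of "y - x"] \<open>x \<ge> x0 + 1\<close> by auto
  moreover
  obtain z where "z \<in> {x-1..x}" "\<bar>f z\<bar> \<le> M" using AE_lebesgue_Icc_ex[OF AE, of "x - 1" x] by auto
  then have "- (M + L) \<le> f x" using slope[of z x] L[of "x - z"] \<open>x \<ge> x0 + 1\<close> by auto
  ultimately show ?thesis by linarith
qed

lemma alpha_nonneg:
  "x \<ge> 0 \<Longrightarrow> alpha N Z E x = of_real (bracket x powi (1 - int (degree Z))) *
     (of_real (N x) - poly Z (of_real x) + E x)"
  by (simp add: alpha_def ext_zero_def)

text \<open>Monotonicity bounds \<open>N x\<close> by its value at a good point y of [x, x + 1],
  where boundedness of \<alpha> compares \<open>N\<close> with the polynomial.\<close>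

lemma counting_function_growth:
  assumes mono: "mono_on {0..} N" and E: "\<And>x. cmod (E x) \<le> Be" "Be \<ge> 0"
    and AE: "AE x in lebesgue. cmod (alpha N Z E x) \<le> M" and "M \<ge> 0"
  obtains C where "C \<ge> 0" "\<And>x. x \<ge> 0 \<Longrightarrow> N x \<le> C * bracket x ^ degree Z"
proof -
  let ?d = "degree Z"
  obtain Cz where Cz: "Cz \<ge> 0" "\<And>x. cmod (poly Z (of_real x)) \<le> Cz * bracket x ^ ?d"
    using poly_le_bracket[of Z] by blast
  have "N x \<le> (Cz + Be + M) * 2 ^ ?d * bracket x ^ ?d" if "x \<ge> 0" for x
  proof -
    obtain y where y: "y \<in> {x..x+1}" "cmod (alpha N Z E y) \<le> M"
      using AE_lebesgue_Icc_ex[OF AE, of x "x + 1"] by auto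
    have pos: "bracket y > 0" and b1: "1 \<le> bracket y ^ ?d"
      using bracket_ge_1[of y] by (auto simp: one_le_power)
    define w where "w = bracket y powi (1 - int ?d)"
    have w: "w > 0" "w * bracket y ^ ?d = bracket y"
      using pos by (auto simp: w_def power_int_diff)
    let ?r = "of_real (N y) - poly Z (of_real y) + E y"
    have "cmod (alpha N Z E y) = w * cmod ?r"
      using y that w(1) unfolding w_def by (subst alpha_nonneg) (auto simp only: norm_mult norm_of_real abs_of_pos atLeastAtMost_iff)
    then have "w * cmod ?r \<le> M"
      using y by simp
    \<comment> \<open>One factor \<open>bracket y\<close>, which is at least 1, is given away so
      that all three contributions share the natural exponent d.\<close>
    then have "w * cmod ?r \<le> w * (M * bracket y ^ ?d)"
      using mult_left_mono[OF bracket_ge_1[of y] \<open>M \<ge> 0\<close>] w(2) by (simp add: mult.left_commute)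
    then have r: "cmod ?r \<le> M * bracket y ^ ?d"
      using w(1) by simp
    have "N x \<le> N y"
      using mono_onD[OF mono, of x y] y that by auto
    also have "N y \<le> cmod (of_real (N y))" by simp
    also have "complex_of_real (N y) = ?r + poly Z (of_real y) - E y" by simp
    also have "cmod (?r + poly Z (of_real y) - E y) \<le> cmod ?r + cmod (poly Z (of_real y)) + cmod (E y)"
      by (intro order_trans[OF norm_triangle_ineq4] add_right_mono norm_triangle_ineq)
    also have "\<dots> \<le> M * bracket y ^ ?d + Cz * bracket y ^ ?d + Be * bracket y ^ ?d"
      using mult_left_mono[OF b1 E(2)] E(1)[of y] by (intro add_mono r Cz(2)) auto
    also have "\<dots> = (Cz + Be + M) * bracket y ^ ?d"
      by (simp add: algebra_simps)
    also have "\<dots> \<le> (Cz + Be + M) * (2 * bracket x) ^ ?d"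
      using y that pos Cz(1) E(2) \<open>M \<ge> 0\<close>
      by (intro mult_left_mono power_mono bracket_le_double) auto
    finally show ?thesis by (simp add: power_mult_distrib mult_ac)
  qed
  moreover have "(Cz + Be + M) * 2 ^ ?d \<ge> 0"
    using Cz(1) E(2) \<open>M \<ge> 0\<close> by simp
  ultimately show thesis using that by blast
qed

text \<open>The product can fall only through its weight, since \<open>N\<close> does not decrease.
  The weight changes at rate at most |1 - d| times the power -d of the bracket at \<open>x\<close>,
  which the growth of \<open>N\<close> at \<open>x\<close> compensates exactly.\<close>

lemma rescaled_monotone_slope:
  assumes mono: "mono_on {0..} N" and N: "\<And>x. x \<ge> 0 \<Longrightarrow> N x > 0"
    and C: "C \<ge> 0" "\<And>x. x \<ge> 0 \<Longrightarrow> N x \<le> C * bracket x ^ d"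
    and "0 \<le> x" "x \<le> y"
  shows "bracket x powi (1 - int d) * N x - (\<bar>1 - real d\<bar> * C) * (y - x) \<le> bracket y powi (1 - int d) * N y"
proof -
  define k where "k = 1 - int d"
  have pos: "bracket t > 0" for t using bracket_ge_1[of t] by linarith
  have "\<bar>bracket y powi k - bracket x powi k\<bar> \<le> (\<bar>1 - real d\<bar> * bracket x powi (- int d)) * (y - x)"
  proof (cases "x = y")
    case False
    let ?c = "\<bar>1 - real d\<bar> * bracket x powi (- int d)"
    have "norm (bracket y powi k - bracket x powi k) \<le> ?c * y - ?c * x"
    proof (rule differentiable_bound_general[of x y "\<lambda>t. bracket t powi k" "\<lambda>t. ?c * t"
          "\<lambda>t. of_int k * bracket t powi (k - 1) * (t / bracket t)" "\<lambda>_. ?c"])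
      show "continuous_on {x..y} (\<lambda>t. bracket t powi k)"
        using bracket_powi_has_derivative by (meson DERIV_isCont continuous_at_imp_continuous_on)
      show "((\<lambda>t. bracket t powi k) has_vector_derivative of_int k * bracket t powi (k - 1) * (t / bracket t)) (at t)" for t
        using bracket_powi_has_derivative by (simp add: has_real_derivative_iff_has_vector_derivative)
      show "((\<lambda>t. ?c * t) has_vector_derivative ?c) (at t)" for t
        by (simp flip: has_real_derivative_iff_has_vector_derivative)
      show "norm (of_int k * bracket t powi (k - 1) * (t / bracket t)) \<le> ?c" if "x < t" for t
      proof -
        have "bracket x ^ d \<le> bracket t ^ d"
          using that \<open>0 \<le> x\<close> pos[of x] by (intro power_mono bracket_mono) auto
        then have "bracket t powi (k - 1) \<le> bracket x powi (- int d)"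
          using pos[of x] pos[of t] by (simp add: k_def power_int_minus le_imp_inverse_le)
        then have "\<bar>of_int k\<bar> * bracket t powi (k - 1) \<le> ?c"
          by (intro mult_mono) (use pos[of t] in \<open>auto simp: k_def\<close>)
        then show ?thesis
          using bracket_powi_deriv_bound[of k t] by simp
      qed
    qed (use False \<open>x \<le> y\<close> in \<open>auto intro!: continuous_intros\<close>)
    then show ?thesis by (simp add: algebra_simps)
  qed simp
  then have "\<bar>bracket y powi k - bracket x powi k\<bar> * N x \<le> ((\<bar>1 - real d\<bar> * bracket x powi (- int d)) * (y - x)) * (C * bracket x ^ d)"
    using C(2)[OF \<open>0 \<le> x\<close>] N[OF \<open>0 \<le> x\<close>] \<open>x \<le> y\<close> pos[of x] by (intro mult_mono) auto
  also have "\<dots> = (\<bar>1 - real d\<bar> * C) * (y - x) * (bracket x powi (- int d) * bracket x ^ d)"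
    by (simp add: mult_ac)
  also have "bracket x powi (- int d) * bracket x ^ d = 1"
    using pos[of x] by (simp add: power_int_minus)
  finally have 1: "\<bar>bracket y powi k - bracket x powi k\<bar> * N x \<le> (\<bar>1 - real d\<bar> * C) * (y - x)"
    by simp
  have "bracket x powi k * N x - bracket y powi k * N x \<le> \<bar>bracket y powi k - bracket x powi k\<bar> * N x"
    unfolding left_diff_distrib[symmetric] using N[OF \<open>0 \<le> x\<close>] by (intro mult_right_mono) auto
  moreover have "bracket y powi k * N x \<le> bracket y powi k * N y"
    using mono_onD[OF mono, of x y] \<open>0 \<le> x\<close> \<open>x \<le> y\<close> pos[of y] by (intro mult_left_mono) auto
  ultimately show ?thesis using 1 by (simp add: k_def)
qed

text \<open>Beyond the support of \<open>E\<close>, \<alpha> is a real function of one-sided slope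
  minus a Lipschitz one. As \<open>N\<close> is real, the imaginary part is Lipschitz; it is stated
  in the same one-sided form so that one Tauberian lemma serves both parts.\<close>

lemma alpha_regularity:
  assumes N: "\<And>\<sigma>. \<sigma> \<ge> 0 \<Longrightarrow> N \<sigma> > 0" and mono: "mono_on {0..} N"
    and E: "E \<in> test_functions {0<..}"
    and AE: "AE x in lebesgue. cmod (alpha N Z E x) \<le> M" and "M \<ge> 0"
  obtains L x0 where "L > 0" "x0 \<ge> 1" "\<And>x. x \<ge> x0 \<Longrightarrow> E x = 0"
    "\<And>x. x \<ge> x0 \<Longrightarrow> \<bar>Re (alpha N Z E x)\<bar> \<le> L" "\<And>x. x \<ge> x0 \<Longrightarrow> \<bar>Im (alpha N Z E x)\<bar> \<le> L"
    "\<And>x y. x0 \<le> x \<Longrightarrow> x \<le> y \<Longrightarrow> y \<le> x + 1 \<Longrightarrow> Re (alpha N Z E x) - L * (y - x) \<le> Re (alpha N Z E y)"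
    "\<And>x y. x0 \<le> x \<Longrightarrow> x \<le> y \<Longrightarrow> y \<le> x + 1 \<Longrightarrow> Im (alpha N Z E x) - L * (y - x) \<le> Im (alpha N Z E y)"
proof -
  let ?\<alpha> = "alpha N Z E"
  obtain Be where Be: "\<And>x. cmod (E x) \<le> Be" "Be \<ge> 0" using test_functions_bounded[OF E] by blast
  have "bounded (closure {x. E x \<noteq> 0})"
    using E by (simp add: test_functions_def compact_imp_bounded)
  then obtain R where R: "\<And>x. x \<in> closure {x. E x \<noteq> 0} \<Longrightarrow> \<bar>x\<bar> \<le> R"
    by (auto simp: bounded_iff)
  have E0: "E x = 0" if "x > R" for x
    using R[of x] closure_subset[of "{x. E x \<noteq> 0}"] that by force
  define x1 where "x1 = max 1 (R + 1)"
  obtain C where C: "C \<ge> 0" "\<And>x. x \<ge> 0 \<Longrightarrow> N x \<le> C * bracket x ^ degree Z"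
    using counting_function_growth[OF mono Be AE \<open>M \<ge> 0\<close>] by blast
  let ?k = "1 - int (degree Z)"
  obtain Lz where "Lz \<ge> 0" and Lz: "\<And>x y. x \<le> y \<Longrightarrow>
      cmod (of_real (bracket y powi ?k) * poly Z (of_real y) - of_real (bracket x powi ?k) * poly Z (of_real x)) \<le> Lz * (y - x)"
    using rescaled_poly_lipschitz[of Z] by blast
  define Ln where "Ln = \<bar>1 - real (degree Z)\<bar> * C"
  \<comment> \<open>\<open>M + Ln + Lz\<close> is the bound supplied by
    \<open>slope_bounded\<close>, and it also dominates the slope \<open>Ln + Lz\<close>; the
    summand 1 ensures positivity.\<close>
  define L where "L = M + Ln + Lz + 1"
  have "Ln \<ge> 0" using C by (simp add: Ln_def)
  define g where "g x = of_real (bracket x powi ?k) * poly Z (of_real x)" for x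
  have \<alpha>: "?\<alpha> x = of_real (bracket x powi ?k * N x) - g x" if "x \<ge> x1" for x
    using that E0[of x] by (simp add: x1_def alpha_nonneg g_def algebra_simps)
  have slopeN: "bracket x powi ?k * N x - Ln * (y - x) \<le> bracket y powi ?k * N y" if "x1 \<le> x" "x \<le> y" for x y
    using rescaled_monotone_slope[OF mono N C, of x y] that by (simp add: x1_def Ln_def)
  have Reg: "\<bar>Re (g y) - Re (g x)\<bar> \<le> Lz * (y - x)" and Img: "\<bar>Im (g y) - Im (g x)\<bar> \<le> Lz * (y - x)"
    if "x \<le> y" for x y
    using order_trans[OF abs_Re_le_cmod Lz[OF that]] order_trans[OF abs_Im_le_cmod Lz[OF that]]
    by (simp_all add: g_def)
  have Re\<alpha>: "Re (?\<alpha> x) = bracket x powi ?k * N x - Re (g x)"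
    and Im\<alpha>: "Im (?\<alpha> x) = - Im (g x)" if "x \<ge> x1" for x
    by (simp_all only: \<alpha>[OF that] minus_complex.sel Re_complex_of_real Im_complex_of_real diff_0)
  have Re: "Re (?\<alpha> x) - (Ln + Lz) * (y - x) \<le> Re (?\<alpha> y)" if "x1 \<le> x" "x \<le> y" for x y
    using slopeN[OF that] Reg[OF that(2)] that by (simp add: Re\<alpha> algebra_simps)
  have Im: "Im (?\<alpha> x) - (Ln + Lz) * (y - x) \<le> Im (?\<alpha> y)" if "x1 \<le> x" "x \<le> y" for x y
  proof -
    have "0 \<le> Ln * (y - x)" using that \<open>Ln \<ge> 0\<close> by simp
    then show ?thesis
      using Img[OF that(2)] that by (simp add: Im\<alpha> algebra_simps)
  qed
  have up: "(Ln + Lz) * (y - x) \<le> L * (y - x)" if "x \<le> y" for x y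
    using that \<open>M \<ge> 0\<close> by (intro mult_right_mono) (auto simp: L_def)
  show thesis
  proof
    show "L > 0" using \<open>M \<ge> 0\<close> \<open>Ln \<ge> 0\<close> \<open>Lz \<ge> 0\<close> by (simp add: L_def)
    \<comment> \<open>The threshold is \<open>x1 + 1\<close> because \<open>slope_bounded\<close>
      looks one unit to the left.\<close>
    show "x1 + 1 \<ge> 1" by (simp add: x1_def)
    show "E x = 0" if "x \<ge> x1 + 1" for x
      using that E0[of x] by (simp add: x1_def)
    have "AE x in lebesgue. \<bar>Re (?\<alpha> x)\<bar> \<le> M"
      using AE by eventually_elim (rule order_trans[OF abs_Re_le_cmod])
    from slope_bounded[OF this _ Re] \<open>Ln \<ge> 0\<close> \<open>Lz \<ge> 0\<close>
    show "\<bar>Re (?\<alpha> x)\<bar> \<le> L" if "x \<ge> x1 + 1" for x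
      using that by (fastforce simp: L_def)
    have "AE x in lebesgue. \<bar>Im (?\<alpha> x)\<bar> \<le> M"
      using AE by eventually_elim (rule order_trans[OF abs_Im_le_cmod])
    from slope_bounded[OF this _ Im] \<open>Ln \<ge> 0\<close> \<open>Lz \<ge> 0\<close>
    show "\<bar>Im (?\<alpha> x)\<bar> \<le> L" if "x \<ge> x1 + 1" for x
      using that by (fastforce simp: L_def)
    show "Re (?\<alpha> x) - L * (y - x) \<le> Re (?\<alpha> y)" if "x1 + 1 \<le> x" "x \<le> y" for x y
      using Re[of x y] up[of x y] that by simp
    show "Im (?\<alpha> x) - L * (y - x) \<le> Im (?\<alpha> y)" if "x1 + 1 \<le> x" "x \<le> y" for x y
      using Im[of x y] up[of x y] that by simp
  qed
qed

subsection \<open>The remainder estimate\<close>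

text \<open>The exponent is -1 for d = 0, so both comparisons occur: x \<le>
  \<open>bracket x\<close> in that case and \<open>bracket x\<close> \<le> 2x otherwise.\<close>

lemma bracket_powi_le:
  assumes "x \<ge> 1"
  shows "bracket x powi (int d - 1) \<le> 2 ^ d * x powi (int d - 1)"
proof (cases d)
  case 0
  have "inverse (bracket x) \<le> inverse x"
    using bracket_ge_abs[of x] assms by (intro le_imp_inverse_le) auto
  then show ?thesis using 0 by (simp add: power_int_minus)
next
  case (Suc n)
  have "bracket x ^ n \<le> (2 * x) ^ n"
  proof (rule power_mono)
    have "bracket x \<le> sqrt ((2 * x)\<^sup>2)"
      unfolding bracket_def
    proof (rule real_sqrt_le_mono)
      have "1 \<le> x\<^sup>2" using assms by simp
      then show "1 + x\<^sup>2 \<le> (2 * x)\<^sup>2" by (simp add: power_mult_distrib)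
    qed
    then show "bracket x \<le> 2 * x" using assms by (simp add: real_sqrt_mult)
  qed (use bracket_ge_1[of x] in auto)
  also have "\<dots> \<le> 2 ^ d * x ^ n"
    using assms Suc by (simp add: power_mult_distrib)
  finally show ?thesis using Suc by simp
qed

text \<open>Passage to the supremum: for X > 0 every admissible \<open>T\<close> is at most D / X,
  and X \<le> D accounts for the 1 in the maximum, so \<open>R0\<close> is finite. For X = 0 it may
  be infinite, with reciprocal 0.\<close>

lemma inverse_R0_bound:
  assumes "X \<ge> 0" "X \<le> D"
    and "\<And>T. T > 0 \<Longrightarrow> T * sobolev1_norm l {-T..T} u \<le> \<Sigma> ^ l \<Longrightarrow> T * X \<le> D"
  shows "X \<le> D * real_of_ereal (inverse (R0 l u \<Sigma>))"
proof (cases "X = 0")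
  case True
  have "0 \<le> real_of_ereal (inverse (R0 l u \<Sigma>))"
    by (intro real_of_ereal_pos) (simp add: R0_def le_max_iff_disj ereal_inverse_nonneg_iff order_trans[OF zero_le_one])
  then show ?thesis using True assms by simp
next
  case False
  then have X: "X > 0" using assms by simp
  have "R0 l u \<Sigma> \<le> ereal (D / X)"
    unfolding R0_def
    using assms X by (auto intro!: SUP_least simp: field_simps one_ereal_def)
  moreover have "1 \<le> R0 l u \<Sigma>" by (simp add: R0_def)
  ultimately obtain r where r: "R0 l u \<Sigma> = ereal r" "r \<ge> 1" "r \<le> D / X"
    by (cases "R0 l u \<Sigma>") auto
  then have "X \<le> D / r" using X by (simp add: field_simps)
  then show ?thesis using r by (simp add: divide_inverse)
qed

lemma set_integral_Re_Im_le:
  fixes f :: "real \<Rightarrow> complex"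
  assumes "set_integrable lebesgue A f"
  shows "\<bar>LINT x:A|lebesgue. Re (f x)\<bar> \<le> cmod (LINT x:A|lebesgue. f x)"
    and "\<bar>LINT x:A|lebesgue. Im (f x)\<bar> \<le> cmod (LINT x:A|lebesgue. f x)"
    and "set_integrable lebesgue A (\<lambda>x. Re (f x))" "set_integrable lebesgue A (\<lambda>x. Im (f x))"
proof -
  have i: "integrable lebesgue (\<lambda>x. indicator A x *\<^sub>R f x)"
    using assms by (simp add: set_integrable_def)
  show "set_integrable lebesgue A (\<lambda>x. Re (f x))" "set_integrable lebesgue A (\<lambda>x. Im (f x))"
    using integrable_Re[OF i] integrable_Im[OF i] by (simp_all add: set_integrable_def)
  have "(LINT x:A|lebesgue. Re (f x)) = Re (LINT x:A|lebesgue. f x)"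
    "(LINT x:A|lebesgue. Im (f x)) = Im (LINT x:A|lebesgue. f x)"
    using integral_Re[OF i] integral_Im[OF i] by (simp_all add: set_lebesgue_integral_def)
  then show "\<bar>LINT x:A|lebesgue. Re (f x)\<bar> \<le> cmod (LINT x:A|lebesgue. f x)"
    "\<bar>LINT x:A|lebesgue. Im (f x)\<bar> \<le> cmod (LINT x:A|lebesgue. f x)"
    by (simp_all add: abs_Re_le_cmod abs_Im_le_cmod)
qed

theorem theorem1p1:
  fixes N :: "real \<Rightarrow> real" and Z :: "complex poly" and E u :: "real \<Rightarrow> complex"
    and d l :: nat
  assumes "\<forall>\<sigma>\<ge>0. N \<sigma> > 0"
    and "piecewise_continuous N"
    and "mono_on {0..} N"
    and "d = degree Z"
    and "E \<in> test_functions {0<..}"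
    and "discrete (sing_supp (distr_fourier (distr_of (ext_zero (\<lambda>\<sigma>. of_real (N \<sigma>))))))"
    and "alpha N Z E \<in> Linfty"
    and "l \<ge> 1"
    and "u \<in> sobolev1_loc l"
    and "distr_eq_on UNIV (distr_fourier (distr_of (alpha N Z E)))
           (distr_of (\<lambda>\<tau>. of_real \<tau> * u \<tau>))"
  shows "(\<lambda>\<Sigma>. of_real (N \<Sigma>) - poly Z (of_real \<Sigma>)) \<in>
           O[at_top](\<lambda>\<Sigma>. of_real (\<Sigma> powi (int d - 1) * inv_sqrt (R0 l u \<Sigma>)))"
proof -
  define \<alpha> where "\<alpha> = alpha N Z E"
  obtain M0 where meas: "\<alpha> \<in> borel_measurable lebesgue" and M0: "AE x in lebesgue. cmod (\<alpha> x) \<le> M0"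
    using assms(7) by (auto simp: Linfty_def \<alpha>_def)
  define M where "M = max M0 0"
  have AE: "AE x in lebesgue. cmod (\<alpha> x) \<le> M"
    using M0 by eventually_elim (simp add: M_def)
  have "M \<ge> 0" by (simp add: M_def)
  have N: "\<And>\<sigma>. \<sigma> \<ge> 0 \<Longrightarrow> N \<sigma> > 0" using assms(1) by blast
  obtain L x0 where "L > 0" "x0 \<ge> 1" and E0: "\<And>x. x \<ge> x0 \<Longrightarrow> E x = 0"
    and bd: "\<And>x. x \<ge> x0 \<Longrightarrow> \<bar>Re (\<alpha> x)\<bar> \<le> L" "\<And>x. x \<ge> x0 \<Longrightarrow> \<bar>Im (\<alpha> x)\<bar> \<le> L"
    and slope: "\<And>x y. x0 \<le> x \<Longrightarrow> x \<le> y \<Longrightarrow> y \<le> x + 1 \<Longrightarrow> Re (\<alpha> x) - L * (y - x) \<le> Re (\<alpha> y)"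
      "\<And>x y. x0 \<le> x \<Longrightarrow> x \<le> y \<Longrightarrow> y \<le> x + 1 \<Longrightarrow> Im (\<alpha> x) - L * (y - x) \<le> Im (\<alpha> y)"
    using alpha_regularity[OF N assms(3,5) AE[unfolded \<alpha>_def] \<open>M \<ge> 0\<close>] unfolding \<alpha>_def by blast
  obtain K where K: "\<And>T \<Sigma> a b. T \<ge> 1 \<Longrightarrow> \<Sigma> > 0 \<Longrightarrow> \<Sigma> / 2 \<le> a \<Longrightarrow> a \<le> b \<Longrightarrow>
      T * sobolev1_norm l {-T..T} u \<le> \<Sigma> ^ l \<Longrightarrow> cmod (LINT x:{a..b}|lebesgue. \<alpha> x) \<le> K / T"
    using average_bound[OF meas AE assms(9), folded \<alpha>_def] assms(10) unfolding \<alpha>_def by blast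
  \<comment> \<open>The first entry adds the Tauberian bounds 4 L K of the real and imaginary parts;
    the second is the trivial bound from both parts being at most \<open>L\<close>.\<close>
  define D where "D = max (8 * L * K) (2 * L\<^sup>2)"
  have "D \<ge> 0" by (simp add: D_def le_max_iff_disj)
  have sq: "(cmod (\<alpha> \<Sigma>))\<^sup>2 \<le> D * real_of_ereal (inverse (R0 l u \<Sigma>))" if "\<Sigma> \<ge> 2 * x0" for \<Sigma>
  proof (rule inverse_R0_bound)
    have "(Re (\<alpha> \<Sigma>))\<^sup>2 \<le> L\<^sup>2" "(Im (\<alpha> \<Sigma>))\<^sup>2 \<le> L\<^sup>2"
      using bd[of \<Sigma>] that \<open>x0 \<ge> 1\<close> \<open>L > 0\<close> by (auto simp: abs_le_square_iff[symmetric])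
    then have triv: "(cmod (\<alpha> \<Sigma>))\<^sup>2 \<le> 2 * L\<^sup>2" by (simp add: cmod_power2)
    then show "(cmod (\<alpha> \<Sigma>))\<^sup>2 \<le> D" by (simp add: D_def)
    fix T assume T: "T > 0" "T * sobolev1_norm l {-T..T} u \<le> \<Sigma> ^ l"
    show "T * (cmod (\<alpha> \<Sigma>))\<^sup>2 \<le> D"
    \<comment> \<open>The average bound is available only for T \<ge> 1; for smaller
      \<open>T\<close> the trivial bound is enough.\<close>
    proof (cases "T \<ge> 1")
      case False
      then have "T * (cmod (\<alpha> \<Sigma>))\<^sup>2 \<le> 1 * (cmod (\<alpha> \<Sigma>))\<^sup>2"
        by (intro mult_right_mono) auto
      then show ?thesis using triv by (simp add: D_def)
    next
      case True
      note si = set_integral_Re_Im_le[OF set_integrable_bounded[OF meas AE]]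
      have K': "cmod (LINT x:{a..b}|lebesgue. \<alpha> x) \<le> K / T" if "\<Sigma> / 2 \<le> a" "a \<le> b" for a b
        using K[OF True _ that T(2)] \<open>\<Sigma> \<ge> 2 * x0\<close> \<open>x0 \<ge> 1\<close> by simp
      have "(Re (\<alpha> \<Sigma>))\<^sup>2 \<le> 4 * L * (K / T)"
        by (rule one_sided_tauberian[OF \<open>L > 0\<close> \<open>x0 \<ge> 1\<close> \<open>\<Sigma> \<ge> 2 * x0\<close> bd(1) slope(1) si(3)
              order_trans[OF si(1) K']])
      moreover have "(Im (\<alpha> \<Sigma>))\<^sup>2 \<le> 4 * L * (K / T)"
        by (rule one_sided_tauberian[OF \<open>L > 0\<close> \<open>x0 \<ge> 1\<close> \<open>\<Sigma> \<ge> 2 * x0\<close> bd(2) slope(2) si(4)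
              order_trans[OF si(2) K']])
      ultimately have "(cmod (\<alpha> \<Sigma>))\<^sup>2 \<le> 2 * (4 * L * (K / T))"
        by (simp only: cmod_power2 mult_2 add_mono)
      then have "T * (cmod (\<alpha> \<Sigma>))\<^sup>2 \<le> 8 * L * K" using T by (simp add: field_simps)
      then show ?thesis by (simp add: D_def)
    qed
  qed simp
  show ?thesis
  proof (rule landau_o.bigI)
    \<comment> \<open>The summand 1 makes the constant positive from \<open>D \<ge> 0\<close> alone.
      The factor \<open>2 ^ d\<close> comes from replacing the bracket by \<Sigma>.\<close>
    show "sqrt D * 2 ^ d + 1 > 0" using \<open>D \<ge> 0\<close> by (smt (verit) mult_nonneg_nonneg real_sqrt_ge_zero zero_le_power)
    show "\<forall>\<^sub>F \<Sigma> in at_top. norm (of_real (N \<Sigma>) - poly Z (of_real \<Sigma>)) \<le>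
        (sqrt D * 2 ^ d + 1) * norm (complex_of_real (\<Sigma> powi (int d - 1) * inv_sqrt (R0 l u \<Sigma>)))"
      using eventually_ge_at_top[of "2 * x0"]
    proof eventually_elim
      fix \<Sigma> assume \<Sigma>: "\<Sigma> \<ge> 2 * x0"
      have pos: "bracket \<Sigma> > 0" using bracket_ge_1[of \<Sigma>] by linarith
      let ?r = "of_real (N \<Sigma>) - poly Z (of_real \<Sigma>)" and ?q = "inv_sqrt (R0 l u \<Sigma>)"
      have q: "?q \<ge> 0" "cmod (\<alpha> \<Sigma>) \<le> sqrt D * ?q"
      proof -
        have "sqrt ((cmod (\<alpha> \<Sigma>))\<^sup>2) \<le> sqrt (D * real_of_ereal (inverse (R0 l u \<Sigma>)))"
          by (rule real_sqrt_le_mono[OF sq[OF \<Sigma>]])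
        then show "cmod (\<alpha> \<Sigma>) \<le> sqrt D * ?q"
          by (simp only: inv_sqrt_def real_sqrt_mult real_sqrt_abs abs_norm_cancel)
        have "0 \<le> real_of_ereal (inverse (R0 l u \<Sigma>))"
          by (intro real_of_ereal_pos) (simp add: R0_def le_max_iff_disj ereal_inverse_nonneg_iff)
        then show "?q \<ge> 0" by (simp add: inv_sqrt_def)
      qed
      have "\<alpha> \<Sigma> = of_real (bracket \<Sigma> powi (1 - int d)) * ?r"
        using \<Sigma> \<open>x0 \<ge> 1\<close> E0[of \<Sigma>] by (simp add: \<alpha>_def alpha_nonneg assms(4))
      then have "cmod (\<alpha> \<Sigma>) = bracket \<Sigma> powi (1 - int d) * cmod ?r"
        using pos by (simp only: norm_mult norm_of_real) simp
      then have "cmod ?r = bracket \<Sigma> powi (int d - 1) * cmod (\<alpha> \<Sigma>)"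
        using pos by (simp add: power_int_diff field_simps)
      also have "\<dots> \<le> (2 ^ d * \<Sigma> powi (int d - 1)) * (sqrt D * ?q)"
        using \<Sigma> \<open>x0 \<ge> 1\<close> pos q by (intro mult_mono bracket_powi_le) auto
      also have "\<dots> = (sqrt D * 2 ^ d) * (\<Sigma> powi (int d - 1) * ?q)"
        by (simp only: mult_ac)
      also have "\<dots> \<le> (sqrt D * 2 ^ d + 1) * (\<Sigma> powi (int d - 1) * ?q)"
        using \<Sigma> \<open>x0 \<ge> 1\<close> q by (intro mult_right_mono) auto
      also have "\<Sigma> powi (int d - 1) * ?q = norm (complex_of_real (\<Sigma> powi (int d - 1) * ?q))"
        unfolding norm_of_real using \<Sigma> \<open>x0 \<ge> 1\<close> q by simp
      finally show "norm ?r \<le> (sqrt D * 2 ^ d + 1) * norm (complex_of_real (\<Sigma> powi (int d - 1) * ?q))" .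
    qed
  qed
qed

end
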